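(* Let $a(x,\xi)$ be a polynomial on $\mathbf R^{2d}$ and let $s\in\overline{\mathbf R_\flat}$. Then the following is true: (1) the operator $a(x,D)$ on $\mathscr S(\mathbf R^d)$ is uniquely extendable to a continuous operator on $\mathcal H_0'(\mathbf R^d)$; (2) the operator $a(x,D)$ on $\mathcal H_0'(\mathbf R^d)$ restricts to a continuous map on any of the spaces $\mathcal H_{0,s}(\mathbf R^d)$ and $\mathcal H_s(\mathbf R^d)$, and their duals.
   Context: $\mathscr S(\mathbf R^d)$ is the Schwartz space. For $a(x,\xi)=\sum a_{\beta,\gamma}x^\beta\xi^\gamma$, $a(x,D)=\sum a_{\beta,\gamma}x^\beta D^\gamma$ with $D_j=-i\partial_{x_j}$ (linear partial differential operator with polynomial coefficients). $\overline{\mathbf R_\flat}=[0,\infty)\cup\{\flat_\sigma\,;\,\sigma>0\}$ with formal symbols $\flat_\sigma$. Let $h_\alpha(x)=\pi^{-d/4}(-1)^{|\alpha|}(2^{|\alpha|}\alpha!)^{-1/2}e^{|x|^2/2}\partial^\alpha e^{-|x|^2}$, $\alpha\in\mathbf N^d$. $\mathcal H_0'(\mathbf R^d)$ is the Fréchet space of all formal Hermite series $f=\sum_\alpha c_\alpha h_\alpha$, $c_\alpha\in\mathbf C$, with the topology of coefficientwise convergence ($\mathscr S(\mathbf R^d)\subseteq\mathcal H_0'(\mathbf R^d)$ via Hermite expansions). $\mathcal H_0(\mathbf R^d)$ consists of finite such sums (inductive limit topology of the finite-dimensional spaces of sums over $|\alpha|\le N$), and $\mathcal H_{0,0}(\mathbf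 R^d)=\{0\}$. For $r>0$ let $\vartheta_{r,s}(\alpha)=e^{r|\alpha|^{1/(2s)}}$ for real $s>0$ and $\vartheta_{r,\flat_\sigma}(\alpha)=r^{|\alpha|}(\alpha!)^{1/(2\sigma)}$. For $s\ne0$, $\mathcal H_s$ ($\mathcal H_{0,s}$) consists of the $f$ with $\sup_\alpha|c_\alpha|\vartheta_{r,s}(\alpha)<\infty$ for some (every) $r>0$, with the inductive (projective) limit topology; the duals $\mathcal H_s'$ ($\mathcal H_{0,s}'$) consist of the $f$ with $\sup_\alpha|c_\alpha|/\vartheta_{r,s}(\alpha)<\infty$ for every (some) $r>0$, with the projective (inductive) limit topology; the dual of $\mathcal H_0$ is $\mathcal H_0'$. *)

theory Defs
  imports "HOL-Analysis.Analysis" "HOL-Library.Poly_Mapping"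
begin

section \<open>Multi-indices and iterated partial derivatives\<close>

type_synonym 'n multi_index = "nat ^ 'n"

definition mi_size :: "('n::finite) multi_index \<Rightarrow> nat" where
  "mi_size \<alpha> = (\<Sum>j\<in>UNIV. \<alpha> $ j)"

definition mi_fact :: "('n::finite) multi_index \<Rightarrow> real" where
  "mi_fact \<alpha> = (\<Prod>j\<in>UNIV. fact (\<alpha> $ j))"

definition mi_power :: "real ^ 'n \<Rightarrow> ('n::finite) multi_index \<Rightarrow> real" where
  "mi_power x \<alpha> = (\<Prod>j\<in>UNIV. (x $ j) ^ (\<alpha> $ j))"

definition partial_deriv ::
    "'n \<Rightarrow> (real ^ 'n \<Rightarrow> 'b::real_normed_vector) \<Rightarrow> real ^ ('n::finite) \<Rightarrow> 'b" where
  "partial_deriv j f x = vector_derivative (\<lambda>t. f (x + t *\<^sub>R axis j 1)) (at 0)"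

text \<open>
  The index type carries no order, so the operator \<open>P\<^sup>\<alpha>\<close> built from operators \<open>P j\<close> applies them in
  some order, each \<open>P j\<close> exactly \<open>\<alpha> $ j\<close> times. For partial derivatives of smooth functions (the
  only case of interest) the order is irrelevant.
\<close>

definition mi_listing :: "('n::finite) multi_index \<Rightarrow> 'n list" where
  "mi_listing \<alpha> = (SOME js. \<forall>j. count_list js j = \<alpha> $ j)"

definition mi_iterate :: "('n \<Rightarrow> 'f \<Rightarrow> 'f) \<Rightarrow> ('n::finite) multi_index \<Rightarrow> 'f \<Rightarrow> 'f" where
  "mi_iterate P \<alpha> f = foldr P (mi_listing \<alpha>) f"

lemma count_list_mi_listing: "count_list (mi_listing \<alpha>) j = \<alpha> $ j"
proof -
  obtain js0 :: "'a list" where js0: "set js0 = UNIV" "distinct js0"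
    using finite_distinct_list[OF finite_class.finite_UNIV] by blast
  have conc: "count_list (concat (map (\<lambda>i. replicate (\<alpha> $ i) i) js)) j =
      (if j \<in> set js then \<alpha> $ j else 0)" if "distinct js" for js :: "'a list" and j
    using that
  proof (induction js)
    case Nil
    show ?case by simp
  next
    case (Cons i js)
    have rep: "count_list (replicate n i) j = (if i = j then n else 0)" for n
      by (induction n) auto
    show ?case using Cons by (auto simp: rep)
  qed
  have "\<exists>js. \<forall>j. count_list js j = \<alpha> $ j"
    by (rule exI[of _ "concat (map (\<lambda>i. replicate (\<alpha> $ i) i) js0)"])
      (simp add: conc[OF js0(2)] js0(1))
  then show ?thesis
    unfolding mi_listing_def by (rule someI2_ex) blast
qed

section \<open>The Schwartz space and operators with polynomial coefficients\<close>

text \<open>All iterated partial derivatives exist and are (totally) differentiable, i.e. \<open>f\<close> is \<open>C\<^sup>\<infinity>\<close>.\<close>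

definition smooth :: "(real ^ ('n::finite) \<Rightarrow> complex) \<Rightarrow> bool" where
  "smooth f \<longleftrightarrow> (\<forall>js. foldr partial_deriv js f differentiable_on UNIV)"

definition schwartz :: "(real ^ ('n::finite) \<Rightarrow> complex) set" where
  "schwartz = {f. smooth f \<and>
     (\<forall>\<alpha> \<beta>. bounded (range (\<lambda>x. of_real (mi_power x \<alpha>) * mi_iterate partial_deriv \<beta> f x)))}"

definition D_op ::
    "'n \<Rightarrow> (real ^ 'n \<Rightarrow> complex) \<Rightarrow> real ^ ('n::finite) \<Rightarrow> complex" where
  "D_op j f x = - \<i> * partial_deriv j f x"

text \<open>
  A polynomial \<open>a(x, \<xi>) = \<Sum> a\<^bsub>\<beta>,\<gamma>\<^esub> x\<^sup>\<beta> \<xi>\<^sup>\<gamma>\<close> on \<open>\<real>\<^bsup>2d\<^esup>\<close> is given by its finitely supported family of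
  complex coefficients.
\<close>

type_synonym 'n symbol_poly = "('n multi_index \<times> 'n multi_index) \<Rightarrow>\<^sub>0 complex"

definition pdo ::
    "('n::finite) symbol_poly \<Rightarrow> (real ^ 'n \<Rightarrow> complex) \<Rightarrow> real ^ 'n \<Rightarrow> complex" where
  "pdo a f x = (\<Sum>(\<beta>, \<gamma>)\<in>Poly_Mapping.keys a.
     Poly_Mapping.lookup a (\<beta>, \<gamma>) * of_real (mi_power x \<beta>) * mi_iterate D_op \<gamma> f x)"

section \<open>Hermite functions and formal Hermite series\<close>

definition hermite_fun :: "('n::finite) multi_index \<Rightarrow> real ^ 'n \<Rightarrow> real" where
  "hermite_fun \<alpha> x =
     pi powr (- real CARD('n) / 4) * (- 1) ^ mi_size \<alpha> *
     (2 ^ mi_size \<alpha> * mi_fact \<alpha>) powr (- 1 / 2) *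
     exp ((norm x)\<^sup>2 / 2) *
     mi_iterate partial_deriv \<alpha> (\<lambda>y. exp (- (norm y)\<^sup>2)) x"

text \<open>
  The formal series \<open>\<Sum>\<^sub>\<alpha> c\<^sub>\<alpha> h\<^sub>\<alpha>\<close> is represented by its coefficient family \<open>c\<close>. A Schwartz function
  is identified with its Hermite expansion, whose coefficients are the \<open>L\<^sup>2\<close> inner products with the
  real-valued, orthonormal functions \<open>h\<^sub>\<alpha>\<close>.
\<close>

type_synonym 'n formal_series = "'n multi_index \<Rightarrow> complex"

definition hermite_expansion :: "(real ^ ('n::finite) \<Rightarrow> complex) \<Rightarrow> 'n formal_series" where
  "hermite_expansion f \<alpha> = (LINT x|lborel. f x * of_real (hermite_fun \<alpha> x))"

definition linear_operator ::
    "(('n::finite) formal_series \<Rightarrow> 'n formal_series) \<Rightarrow> bool" where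
  "linear_operator T \<longleftrightarrow>
     (\<forall>c d. T (\<lambda>\<alpha>. c \<alpha> + d \<alpha>) = (\<lambda>\<alpha>. T c \<alpha> + T d \<alpha>)) \<and>
     (\<forall>k c. T (\<lambda>\<alpha>. k * c \<alpha>) = (\<lambda>\<alpha>. k * T c \<alpha>))"

section \<open>Locally convex topologies on spaces of formal series\<close>

definition seminorm_on ::
    "('n::finite) formal_series set \<Rightarrow> ('n formal_series \<Rightarrow> real) \<Rightarrow> bool" where
  "seminorm_on E p \<longleftrightarrow>
     (\<forall>c\<in>E. 0 \<le> p c) \<and>
     (\<forall>c\<in>E. \<forall>d\<in>E. p (\<lambda>\<alpha>. c \<alpha> + d \<alpha>) \<le> p c + p d) \<and>
     (\<forall>k. \<forall>c\<in>E. p (\<lambda>\<alpha>. k * c \<alpha>) = cmod k * p c)"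

definition seminorm_topology ::
    "('n::finite) formal_series set \<Rightarrow> ('n formal_series \<Rightarrow> real) set \<Rightarrow> 'n formal_series topology"
  where
  "seminorm_topology E P = topology_generated_by
     {{d \<in> E. p (\<lambda>\<alpha>. d \<alpha> - c \<alpha>) < \<epsilon>} | p c \<epsilon>. p \<in> P \<and> c \<in> E \<and> 0 < \<epsilon>}"

text \<open>
  For normed spaces \<open>(E i, N i)\<close>, \<open>i \<in> I\<close>, the projective limit topology on \<open>\<Inter>i\<in>I. E i\<close> is the
  coarsest one making all inclusions into the \<open>E i\<close> continuous; it is the topology of the seminorms
  \<open>N i\<close>. The inductive limit topology on \<open>\<Union>i\<in>I. E i\<close> is the finest locally convex one making all
  inclusions of the \<open>E i\<close> continuous; it is the topology of all seminorms whose restriction to each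
  \<open>E i\<close> is continuous, i.e. bounded by a multiple of \<open>N i\<close>. (In all uses below the \<open>E i\<close> form a
  chain, so that the union is a vector space.)
\<close>

definition projective_limit ::
    "'i set \<Rightarrow> ('i \<Rightarrow> ('n::finite) formal_series set) \<Rightarrow> ('i \<Rightarrow> 'n formal_series \<Rightarrow> real) \<Rightarrow>
     'n formal_series topology" where
  "projective_limit I E N = seminorm_topology (\<Inter>i\<in>I. E i) (N ` I)"

definition inductive_limit ::
    "'i set \<Rightarrow> ('i \<Rightarrow> ('n::finite) formal_series set) \<Rightarrow> ('i \<Rightarrow> 'n formal_series \<Rightarrow> real) \<Rightarrow>
     'n formal_series topology" where
  "inductive_limit I E N = seminorm_topology (\<Union>i\<in>I. E i)
     {p. seminorm_on (\<Union>i\<in>I. E i) p \<and> (\<forall>i\<in>I. \<exists>C. \<forall>c\<in>E i. p c \<le> C * N i c)}"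

lemma topspace_seminorm_topology:
  assumes "p \<in> P" and "\<And>c. c \<in> E \<Longrightarrow> p (\<lambda>_. 0) = 0"
  shows "topspace (seminorm_topology E P) = E"
proof -
  let ?B = "\<lambda>q c \<epsilon>. {d \<in> E. q (\<lambda>\<alpha>. d \<alpha> - c \<alpha>) < \<epsilon>}"
  let ?S = "{?B q c \<epsilon> | q c \<epsilon>. q \<in> P \<and> c \<in> E \<and> 0 < (\<epsilon>::real)}"
  have "c \<in> \<Union>?S" if "c \<in> E" for c
  proof (rule UnionI)
    show "?B p c 1 \<in> ?S" using assms(1) that zero_less_one by blast
    show "c \<in> ?B p c 1" using that assms(2)[OF that] by simp
  qed
  moreover have "\<Union>?S \<subseteq> E" by blast
  ultimately show ?thesis
    unfolding seminorm_topology_def topology_generated_by_topspace by blast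
qed

lemma topspace_inductive_limit:
  assumes "\<And>i c. i \<in> I \<Longrightarrow> c \<in> E i \<Longrightarrow> 0 \<le> N i c"
  shows "topspace (inductive_limit I E N) = (\<Union>i\<in>I. E i)"
  unfolding inductive_limit_def
proof (rule topspace_seminorm_topology[where p = "\<lambda>_. 0"])
  have "\<forall>i\<in>I. \<exists>C. \<forall>c\<in>E i. 0 \<le> C * N i c"
    using assms mult_1 by metis
  then show "(\<lambda>_. 0) \<in> {p. seminorm_on (\<Union>i\<in>I. E i) p \<and>
      (\<forall>i\<in>I. \<exists>C. \<forall>c\<in>E i. p c \<le> C * N i c)}"
    by (simp add: seminorm_on_def)
qed simp

section \<open>The spaces\<close>

text \<open>The set \<open>[0, \<infinity>) \<union> {\<flat>\<^sub>\<sigma>; \<sigma> > 0}\<close>.\<close>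

datatype flat_index = Real_index real | Flat real

definition Rflat_closure :: "flat_index set" where
  "Rflat_closure = Real_index ` {0..} \<union> Flat ` {0<..}"

fun weight :: "real \<Rightarrow> flat_index \<Rightarrow> ('n::finite) multi_index \<Rightarrow> real" where
  "weight r (Real_index s) \<alpha> = exp (r * real (mi_size \<alpha>) powr (1 / (2 * s)))"
| "weight r (Flat \<sigma>) \<alpha> = r ^ mi_size \<alpha> * mi_fact \<alpha> powr (1 / (2 * \<sigma>))"

definition weighted_space ::
    "(('n::finite) multi_index \<Rightarrow> real) \<Rightarrow> 'n formal_series set" where
  "weighted_space w = {c. bdd_above (range (\<lambda>\<alpha>. cmod (c \<alpha>) * w \<alpha>))}"

definition weighted_norm ::
    "(('n::finite) multi_index \<Rightarrow> real) \<Rightarrow> 'n formal_series \<Rightarrow> real" where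
  "weighted_norm w c = (SUP \<alpha>. cmod (c \<alpha>) * w \<alpha>)"

text \<open>Coefficientwise convergence, i.e. the product topology: the space of all formal series.\<close>

definition formal_topology :: "('n::finite) formal_series topology" where
  "formal_topology = product_topology (\<lambda>_. euclidean) UNIV"

text \<open>On sums over \<open>|\<alpha>| \<le> N\<close> all norms are equivalent; we take the maximum norm.\<close>

definition finite_topology :: "('n::finite) formal_series topology" where
  "finite_topology = inductive_limit (UNIV :: nat set)
     (\<lambda>N. {c. \<forall>\<alpha>. N < mi_size \<alpha> \<longrightarrow> c \<alpha> = 0}) (\<lambda>_. weighted_norm (\<lambda>_. 1))"

text \<open>
  The topological spaces \<open>\<H>\<^sub>s\<close>, \<open>\<H>\<^bsub>0,s\<^esub>\<close> and their duals. For \<open>s = 0\<close>, \<open>\<H>\<^bsub>0,0\<^esub> = {0}\<close> and hence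
  its dual is \<open>{0}\<close> as well.
\<close>

definition H_space :: "flat_index \<Rightarrow> ('n::finite) formal_series topology" where
  "H_space s = (if s = Real_index 0 then finite_topology
     else inductive_limit {0<..} (\<lambda>r. weighted_space (weight r s)) (\<lambda>r. weighted_norm (weight r s)))"

definition H0_space :: "flat_index \<Rightarrow> ('n::finite) formal_series topology" where
  "H0_space s = (if s = Real_index 0 then discrete_topology {\<lambda>_. 0}
     else projective_limit {0<..} (\<lambda>r. weighted_space (weight r s)) (\<lambda>r. weighted_norm (weight r s)))"

definition H_dual :: "flat_index \<Rightarrow> ('n::finite) formal_series topology" where
  "H_dual s = (if s = Real_index 0 then formal_topology
     else projective_limit {0<..} (\<lambda>r. weighted_space (\<lambda>\<alpha>. 1 / weight r s \<alpha>))
       (\<lambda>r. weighted_norm (\<lambda>\<alpha>. 1 / weight r s \<alpha>)))"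

definition H0_dual :: "flat_index \<Rightarrow> ('n::finite) formal_series topology" where
  "H0_dual s = (if s = Real_index 0 then discrete_topology {\<lambda>_. 0}
     else inductive_limit {0<..} (\<lambda>r. weighted_space (\<lambda>\<alpha>. 1 / weight r s \<alpha>))
       (\<lambda>r. weighted_norm (\<lambda>\<alpha>. 1 / weight r s \<alpha>)))"

section \<open>Extension of the operator\<close>

definition is_continuous_extension ::
    "('n::finite) symbol_poly \<Rightarrow> ('n formal_series \<Rightarrow> 'n formal_series) \<Rightarrow> bool" where
  "is_continuous_extension a T \<longleftrightarrow>
     linear_operator T \<and>
     continuous_map formal_topology formal_topology T \<and>
     (\<forall>f\<in>schwartz. T (hermite_expansion f) = hermite_expansion (pdo a f))"

end

theory Submission
  imports Defs "HOL-Probability.Sinc_Integral" "HOL-Real_Asymp.Real_Asymp"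
begin

text \<open>
  Multiplication by \<open>x\<^sub>j\<close> and differentiation \<open>\<partial>\<^sub>j\<close> are linear combinations of the creation operator
  \<open>x\<^sub>j - \<partial>\<^sub>j\<close> and the annihilation operator \<open>x\<^sub>j + \<partial>\<^sub>j\<close>, which map the Hermite function \<open>h\<^sub>\<alpha>\<close> to multiples
  of \<open>h\<^bsub>\<alpha> + e\<^sub>j\<^esub>\<close> and \<open>h\<^bsub>\<alpha> - e\<^sub>j\<^esub>\<close> with factors \<open>\<surd>(2 (\<alpha>\<^sub>j + 1))\<close> and \<open>\<surd>(2 \<alpha>\<^sub>j)\<close>
  (\<open>raise_hermite\<close>, \<open>lower_hermite\<close>). The Hermite functions are obtained from the Gaussian by creation
  operators (\<open>hermite_eq_excited\<close>), so this is a consequence of the canonical commutation relations.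
  Integrating by parts, one finds that the two operators act on Hermite coefficients of Schwartz
  functions as weighted shifts \<open>up j\<close> and \<open>down j\<close> (\<open>hermite_expansion_raise\<close>,
  \<open>hermite_expansion_lower\<close>). Hence every differential operator with polynomial coefficients acts on
  coefficients as an element of the algebra generated by these shifts (\<open>ladder_represented_pdo\<close>).

  Elements of this algebra make sense for arbitrary coefficient families and are continuous for
  coefficientwise convergence, because every coefficient of the result involves only finitely many
  coefficients of the argument. This is the extension. It is unique because the expansions of Schwartz
  functions contain all finite series, which are dense (\<open>extension_unique\<close>).

  For the weighted spaces it remains to consider the generators. A shift changes the weight at an index
  by passing to a neighbour and costs a further factor of the order of the square root of the index.
  Both effects are compensated by an arbitrarily small change of the parameter \<open>r\<close>
  (\<open>ladder_dominated_weight\<close>), and passing to reciprocal weights merely exchanges the two shifts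
  (\<open>ladder_dominated_inverse\<close>). Such a loss is invisible to the projective and inductive limits
  over \<open>r\<close> (\<open>continuous_weighted\<close>). For \<open>s = 0\<close> the spaces are those of finite and of all formal series,
  and the zero space.
\<close>

section \<open>Partial derivatives\<close>

lemma partial_deriv_eq:
  assumes "(f has_derivative f') (at x)"
  shows "partial_deriv j f x = f' (axis j 1)"
proof -
  have "((\<lambda>t. x + t *\<^sub>R axis j 1) has_derivative (\<lambda>t. t *\<^sub>R axis j 1)) (at 0)"
    by (auto intro!: derivative_eq_intros)
  from has_derivative_compose[OF this, of f f'] assms
  have "((\<lambda>t. f (x + t *\<^sub>R axis j 1)) has_derivative (\<lambda>t. f' (t *\<^sub>R axis j 1))) (at 0)"
    by simp
  then have "((\<lambda>t. f (x + t *\<^sub>R axis j 1)) has_vector_derivative f' (axis j 1)) (at 0)"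
    unfolding has_vector_derivative_def
    using linear_cmul[OF has_derivative_linear[OF assms]] by simp
  then show ?thesis
    unfolding partial_deriv_def by (rule vector_derivative_at)
qed

lemma has_vector_derivative_along_axis:
  assumes "f differentiable (at (x + t *\<^sub>R axis j 1))"
  shows "((\<lambda>t. f (x + t *\<^sub>R axis j 1)) has_vector_derivative
    partial_deriv j f (x + t *\<^sub>R axis j 1)) (at t)"
proof -
  obtain f' where f': "(f has_derivative f') (at (x + t *\<^sub>R axis j 1))"
    using assms unfolding differentiable_def by blast
  have "((\<lambda>t. x + t *\<^sub>R axis j 1) has_derivative (\<lambda>t. t *\<^sub>R axis j 1)) (at t)"
    by (auto intro!: derivative_eq_intros)
  from has_derivative_compose[OF this f']
  show ?thesis
    unfolding has_vector_derivative_def partial_deriv_eq[OF f']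
    using linear_cmul[OF has_derivative_linear[OF f']] by simp
qed

lemma partial_deriv_mult:
  fixes f g :: "real ^ 'n::finite \<Rightarrow> 'a::real_normed_algebra"
  assumes "f differentiable (at x)" "g differentiable (at x)"
  shows "partial_deriv j (\<lambda>x. f x * g x) x = f x * partial_deriv j g x + partial_deriv j f x * g x"
proof -
  obtain f' g' where *: "(f has_derivative f') (at x)" "(g has_derivative g') (at x)"
    using assms unfolding differentiable_def by blast
  show ?thesis
    using partial_deriv_eq[OF has_derivative_mult[OF *], of j] *[THEN partial_deriv_eq] by simp
qed

lemma partial_deriv_add:
  assumes "f differentiable (at x)" "g differentiable (at x)"
  shows "partial_deriv j (\<lambda>x. f x + g x) x = partial_deriv j f x + partial_deriv j g x"
proof -
  obtain f' g' where *: "(f has_derivative f') (at x)" "(g has_derivative g') (at x)"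
    using assms unfolding differentiable_def by blast
  show ?thesis
    using partial_deriv_eq[OF has_derivative_add[OF *], of j] *[THEN partial_deriv_eq] by simp
qed

lemma partial_deriv_bounded_linear:
  assumes "bounded_linear h" "f differentiable (at x)"
  shows "partial_deriv j (\<lambda>x. h (f x)) x = h (partial_deriv j f x)"
proof -
  obtain f' where *: "(f has_derivative f') (at x)"
    using assms unfolding differentiable_def by blast
  show ?thesis
    using partial_deriv_eq[OF bounded_linear.has_derivative[OF assms(1) *], of j]
      partial_deriv_eq[OF *] by simp
qed

lemma partial_deriv_cmult:
  fixes f :: "real ^ 'n::finite \<Rightarrow> 'a::real_normed_algebra"
  assumes "f differentiable (at x)"
  shows "partial_deriv j (\<lambda>x. k * f x) x = k * partial_deriv j f x"
  using partial_deriv_bounded_linear[OF bounded_linear_mult_right assms] .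

lemma has_derivative_coord:
  "((\<lambda>x. of_real (x $ j)) has_derivative (\<lambda>h. of_real (h $ j) :: complex)) (at x)"
  by (intro has_derivative_of_real bounded_linear_imp_has_derivative bounded_linear_vec_nth)

lemma differentiable_coord: "(\<lambda>x. of_real (x $ j) :: complex) differentiable (at x)"
  using has_derivative_coord unfolding differentiable_def by blast

lemma partial_deriv_coord:
  "partial_deriv i (\<lambda>x. of_real (x $ j) :: complex) x = (if i = j then 1 else 0)"
  by (simp add: partial_deriv_eq[OF has_derivative_coord] axis_def)

lemma partial_deriv_coord_mult:
  fixes f :: "real ^ 'n::finite \<Rightarrow> complex"
  assumes "f differentiable (at x)"
  shows "partial_deriv i (\<lambda>x. of_real (x $ j) * f x) x =
    of_real (x $ j) * partial_deriv i f x + (if i = j then f x else 0)"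
  by (simp add: partial_deriv_mult[OF differentiable_coord assms] partial_deriv_coord)

lemma smooth_differentiable:
  "smooth f \<Longrightarrow> f differentiable (at x)"
  unfolding smooth_def differentiable_on_def by (drule spec[of _ "[]"]) simp

lemma smooth_partial_deriv:
  assumes "smooth f" shows "smooth (partial_deriv j f)"
  unfolding smooth_def
proof
  fix js
  have "foldr partial_deriv (js @ [j]) f differentiable_on UNIV"
    using assms unfolding smooth_def by blast
  then show "foldr partial_deriv js (partial_deriv j f) differentiable_on UNIV" by simp
qed

lemma smooth_continuous: "smooth f \<Longrightarrow> continuous_on S f"
  by (auto intro!: continuous_at_imp_continuous_on differentiable_imp_continuous_within smooth_differentiable)

text \<open>
  Equality of mixed partial derivatives: differentiating
  \<open>f(x + s e\<^sub>i + t e\<^sub>j) = f(x - e\<^sub>i + t e\<^sub>j) + \<integral>\<^bsub>-1\<^esub>\<^bsup>s\<^esup> (\<partial>\<^sub>i f)(x + u e\<^sub>i + t e\<^sub>j) du\<close> under the integral in \<open>t\<close>, and then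
  in the upper bound \<open>s\<close>, gives \<open>\<partial>\<^sub>i \<partial>\<^sub>j f = \<partial>\<^sub>j \<partial>\<^sub>i f\<close>.
\<close>

lemma partial_deriv_commute:
  fixes f :: "real ^ 'n::finite \<Rightarrow> complex"
  assumes "smooth f"
  shows "partial_deriv i (partial_deriv j f) = partial_deriv j (partial_deriv i f)"
proof
  fix x :: "real ^ 'n"
  let ?P = "partial_deriv i f" and ?R = "partial_deriv j f"
  let ?Q = "partial_deriv j ?P"
  have sm: "smooth ?P" "smooth ?R" "smooth ?Q"
    by (intro smooth_partial_deriv assms)+
  let ?y = "\<lambda>s t. x + s *\<^sub>R axis i 1 + t *\<^sub>R axis j 1"
  \<comment> \<open>the integral starts at \<open>-1\<close> so that the point \<open>s = 0\<close> of interest is interior\<close>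
  have ftc: "f (?y s t) = f (?y (-1) t) + integral (cbox (-1) s) (\<lambda>u. ?P (?y u t))"
    if "-1 \<le> s" for s t
  proof -
    have "((\<lambda>u. f ((x + t *\<^sub>R axis j 1) + u *\<^sub>R axis i 1)) has_vector_derivative
        ?P ((x + t *\<^sub>R axis j 1) + u *\<^sub>R axis i 1)) (at u within {-1..s})" for u
      by (rule has_vector_derivative_at_within[OF has_vector_derivative_along_axis[OF
            smooth_differentiable[OF assms]]])
    from integral_unique[OF fundamental_theorem_of_calculus[OF that this]]
    have "integral {-1..s} (\<lambda>u. ?P ((x + t *\<^sub>R axis j 1) + u *\<^sub>R axis i 1)) =
      f ((x + t *\<^sub>R axis j 1) + s *\<^sub>R axis i 1) - f ((x + t *\<^sub>R axis j 1) + (-1) *\<^sub>R axis i 1)" .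
    then show ?thesis by (simp only: add.assoc add.commute[of "t *\<^sub>R _"] cbox_interval) simp
  qed
  have R: "?R (?y s 0) = ?R (?y (-1) 0) + integral {-1..s} (\<lambda>u. ?Q (?y u 0))" if "-1 \<le> s" for s
  proof -
    have "((\<lambda>t. integral (cbox (-1) s) (\<lambda>u. ?P (?y u t))) has_vector_derivative
        integral (cbox (-1) s) (\<lambda>u. ?Q (?y u 0))) (at 0 within UNIV)"
    proof (rule leibniz_rule_vector_derivative)
      show "((\<lambda>t. ?P (?y u t)) has_vector_derivative ?Q (?y u t)) (at t within UNIV)" for u t
        using has_vector_derivative_along_axis[OF smooth_differentiable[OF sm(1)]] by simp
      show "(\<lambda>u. ?P (?y u t)) integrable_on cbox (-1) s" for t
        by (intro integrable_continuous continuous_on_compose2[OF smooth_continuous[OF sm(1), of UNIV]]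
            continuous_intros) auto
      show "continuous_on (UNIV \<times> cbox (-1) s) (\<lambda>(t, u). ?Q (?y u t))"
        unfolding split_def
        by (intro continuous_on_compose2[OF smooth_continuous[OF sm(3), of UNIV]]
            continuous_intros) auto
    qed auto
    from has_vector_derivative_add[OF has_vector_derivative_along_axis[OF smooth_differentiable[OF assms]] this]
    have "((\<lambda>t. f (?y s t)) has_vector_derivative
        ?R (?y (-1) 0) + integral {-1..s} (\<lambda>u. ?Q (?y u 0))) (at 0)"
      by (subst ftc[OF that]) simp
    moreover have "((\<lambda>t. f (?y s t)) has_vector_derivative ?R (?y s 0)) (at 0)"
      by (rule has_vector_derivative_along_axis[OF smooth_differentiable[OF assms]])
    ultimately show ?thesis
      by (rule vector_derivative_unique_at[rotated])
  qed
  have "((\<lambda>s. integral {-1..s} (\<lambda>u. ?Q (?y u 0))) has_vector_derivative ?Q (?y 0 0))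
      (at 0 within {-1..1})"
    by (rule integral_has_vector_derivative)
      (auto intro!: continuous_on_compose2[OF smooth_continuous[OF sm(3), of UNIV]] continuous_intros)
  then have "((\<lambda>s. integral {-1..s} (\<lambda>u. ?Q (?y u 0))) has_vector_derivative ?Q (?y 0 0)) (at 0)"
    by (simp add: at_within_Icc_at)
  from has_vector_derivative_add[OF has_vector_derivative_const[of "?R (?y (-1) 0)"] this]
  have "((\<lambda>s. ?R (?y (-1) 0) + integral {-1..s} (\<lambda>u. ?Q (?y u 0))) has_vector_derivative
      ?Q (?y 0 0)) (at 0)"
    by (simp only: add_0)
  then have "((\<lambda>s. ?R (?y s 0)) has_vector_derivative ?Q (?y 0 0)) (at 0)"
  proof (rule has_vector_derivative_transform_within_open)
    show "open {-1<..<1::real}" by simp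
    show "?R (?y (-1) 0) + integral {-1..s} (\<lambda>u. ?Q (?y u 0)) = ?R (?y s 0)" if "s \<in> {-1<..<1}" for s
      using R[of s] that by (simp only: greaterThanLessThan_iff less_imp_le)
  qed simp
  moreover have "((\<lambda>s. ?R (?y s 0)) has_vector_derivative partial_deriv i ?R (?y 0 0)) (at 0)"
    using has_vector_derivative_along_axis[where x = x and t = 0 and j = i, OF smooth_differentiable[OF sm(2)]]
    by simp
  ultimately have "?Q (?y 0 0) = partial_deriv i ?R (?y 0 0)"
    by (rule vector_derivative_unique_at)
  then show "partial_deriv i ?R x = ?Q x" by simp
qed

section \<open>Iterating commuting operators\<close>

text \<open>
  The operators \<open>P j\<close> commute only on a set \<open>K\<close> of well-behaved functions that they leave invariant
  (smooth functions for partial derivatives, Schwartz functions for creation operators), so that a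
  permutation of the list has to be undone one element at a time.
\<close>
lemma foldr_commuting_move:
  assumes inv: "\<And>j f. f \<in> K \<Longrightarrow> P j f \<in> K"
    and comm: "\<And>i j f. f \<in> K \<Longrightarrow> P i (P j f) = P j (P i f)"
    and "f \<in> K"
  shows "foldr P (xs @ y # ys) f = P y (foldr P (xs @ ys) f)"
proof -
  have K: "foldr P zs f \<in> K" for zs
    by (induction zs) (auto intro: inv \<open>f \<in> K\<close>)
  have "foldr P xs (P y (foldr P ys f)) = P y (foldr P xs (foldr P ys f))"
  proof (induction xs)
    case (Cons x xs)
    have "foldr P xs (foldr P ys f) \<in> K" using K[of "xs @ ys"] by simp
    from comm[OF this] Cons show ?case by simp
  qed simp
  then show ?thesis by simp
qed

lemma foldr_commuting_permute:
  assumes inv: "\<And>j f. f \<in> K \<Longrightarrow> P j f \<in> K"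
    and comm: "\<And>i j f. f \<in> K \<Longrightarrow> P i (P j f) = P j (P i f)"
    and f: "f \<in> K" and "mset xs = mset ys"
  shows "foldr P xs f = foldr P ys f"
  using \<open>mset xs = mset ys\<close>
proof (induction xs arbitrary: ys)
  case (Cons x xs)
  then have "x \<in> set ys" by (metis list.set_intros(1) mset_eq_setD)
  then obtain us vs where ys: "ys = us @ x # vs" by (meson split_list)
  have "foldr P xs f = foldr P (us @ vs) f"
    using Cons.prems by (intro Cons.IH) (simp add: ys)
  then show ?case
    by (simp only: ys foldr_commuting_move[of K P f us x vs, OF inv comm f]) simp
qed simp

lemma mset_eq_iff_count_list: "mset xs = mset ys \<longleftrightarrow> (\<forall>j. count_list xs j = count_list ys j)"
  by (simp add: multiset_eq_iff count_mset)

section \<open>Closure properties of the Schwartz space\<close>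

lemma bounded_range_iff: "bounded (range f) \<longleftrightarrow> (\<exists>B. \<forall>x. norm (f x) \<le> B)"
  by (auto simp: bounded_iff)

lemma schwartz_smooth: "f \<in> schwartz \<Longrightarrow> smooth f"
  by (simp add: schwartz_def)

lemma schwartz_differentiable: "f \<in> schwartz \<Longrightarrow> f differentiable (at x)"
  by (simp add: schwartz_smooth smooth_differentiable)

lemma mi_power_add_axis:
  "mi_power x (\<alpha> + axis j 1) = mi_power x \<alpha> * x $ j"
proof -
  have "mi_power x (axis j 1) = x $ j"
    unfolding mi_power_def axis_def
    by (simp add: if_distrib[of "\<lambda>n. _ ^ n"] cong: if_cong)
  then show ?thesis
    by (simp add: mi_power_def power_add prod.distrib)
qed

text \<open>
  The seminorms of a Schwartz function are given for one chosen listing of each multi-index. Mixed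
  partial derivatives commute, so they control the derivatives along every list.
\<close>
lemma schwartz_bounded_listing:
  assumes "f \<in> schwartz"
  shows "bounded (range (\<lambda>x. of_real (mi_power x \<alpha>) * foldr partial_deriv js f x))"
proof -
  let ?\<beta> = "(\<chi> j. count_list js j) :: nat ^ 'a"
  have "mset (mi_listing ?\<beta>) = mset js"
    by (simp add: mset_eq_iff_count_list count_list_mi_listing)
  then have "mi_iterate partial_deriv ?\<beta> f = foldr partial_deriv js f"
    unfolding mi_iterate_def
    using schwartz_smooth[OF assms] smooth_partial_deriv partial_deriv_commute
    by (intro foldr_commuting_permute[where K = "Collect smooth"]) auto
  then show ?thesis
    using assms unfolding schwartz_def by (auto dest: spec2[of _ \<alpha> ?\<beta>])
qed

text \<open>
  The module generated by \<open>G\<close> over the polynomials in the coordinates.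
\<close>
inductive_set coord_span :: "(real ^ 'n::finite \<Rightarrow> complex) set \<Rightarrow> (real ^ 'n \<Rightarrow> complex) set"
  for G where
  base: "g \<in> G \<Longrightarrow> g \<in> coord_span G"
| add: "f \<in> coord_span G \<Longrightarrow> g \<in> coord_span G \<Longrightarrow> (\<lambda>x. f x + g x) \<in> coord_span G"
| scale: "f \<in> coord_span G \<Longrightarrow> (\<lambda>x. k * f x) \<in> coord_span G"
| coord: "f \<in> coord_span G \<Longrightarrow> (\<lambda>x. of_real (x $ j) * f x) \<in> coord_span G"

text \<open>
  If the partial derivatives of the generators are again in the module, the Leibniz rule makes the
  whole module invariant under differentiation. As a monomial times an element of the module is again
  in the module, bounds for monomials times generators are then all that membership in the Schwartz
  space asks for.
\<close>
lemma coord_span_subset_schwartz: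
  assumes diff: "\<And>g x. g \<in> G \<Longrightarrow> g differentiable (at x)"
    and pd: "\<And>g j. g \<in> G \<Longrightarrow> partial_deriv j g \<in> coord_span G"
    and bdd: "\<And>g \<alpha>. g \<in> G \<Longrightarrow> bounded (range (\<lambda>x. of_real (mi_power x \<alpha>) * g x))"
  shows "coord_span G \<subseteq> schwartz"
proof
  fix f assume f: "f \<in> coord_span G"
  have D: "(\<forall>x. h differentiable (at x)) \<and> (\<forall>j. partial_deriv j h \<in> coord_span G)"
    if "h \<in> coord_span G" for h
    using that
  proof induction
    case (base g)
    then show ?case using diff pd by blast
  next
    case (add f g)
    then have "partial_deriv i (\<lambda>x. f x + g x) = (\<lambda>x. partial_deriv i f x + partial_deriv i g x)" for i
      by (auto simp: partial_deriv_add)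
    with add show ?case by (simp add: coord_span.add)
  next
    case (scale f k)
    then have "partial_deriv i (\<lambda>x. k * f x) = (\<lambda>x. k * partial_deriv i f x)" for i
      by (auto simp: partial_deriv_cmult)
    with scale show ?case by (simp add: coord_span.scale)
  next
    case (coord f j)
    then have "partial_deriv i (\<lambda>x. of_real (x $ j) * f x) =
        (\<lambda>x. of_real (x $ j) * partial_deriv i f x + (if i = j then 1 else 0) * f x)" for i
      by (auto simp: partial_deriv_coord_mult)
    with coord show ?case
      by (simp add: coord_span.intros differentiable_coord del: if_split_asm mult_if_delta)
  qed
  have bd: "bounded (range (\<lambda>x. of_real (mi_power x \<alpha>) * h x))" if "h \<in> coord_span G" for h \<alpha>
    using that
  proof (induction arbitrary: \<alpha>)
    case (base g)
    then show ?case using bdd by blast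
  next
    case (add f g)
    then show ?case
      by (simp add: distrib_left bounded_plus_comp)
  next
    case (scale f k)
    obtain B where "norm (of_real (mi_power x \<alpha>) * f x) \<le> B" for x
      using scale.IH[of \<alpha>] unfolding bounded_range_iff by blast
    then have "norm (of_real (mi_power x \<alpha>) * (k * f x)) \<le> norm k * B" for x
      using mult_left_mono[of "norm (of_real (mi_power x \<alpha>) * f x)" B "norm k"]
      by (simp add: norm_mult ac_simps)
    then show ?case unfolding bounded_range_iff by blast
  next
    case (coord f j)
    from coord.IH[of "\<alpha> + axis j 1"] show ?case
      unfolding mi_power_add_axis by (simp add: mult.assoc)
  qed
  have it: "foldr partial_deriv js f \<in> coord_span G" for js
    using f D by (induction js) auto
  then have "smooth f"
    unfolding smooth_def differentiable_on_def using D by simp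
  then show "f \<in> schwartz"
    unfolding schwartz_def mi_iterate_def using bd[OF it] by simp
qed

text \<open>
  The generators are all iterated derivatives of Schwartz functions. The closure properties of the
  Schwartz space, in particular under multiplication by a coordinate, are read off from this.
\<close>
lemma schwartz_eq_coord_span:
  "(schwartz :: (real ^ 'n::finite \<Rightarrow> complex) set) =
    coord_span {foldr partial_deriv js f | js f. f \<in> schwartz}"
proof
  let ?G = "{foldr partial_deriv js f | js f. f \<in> schwartz} :: (real ^ 'n \<Rightarrow> complex) set"
  have G: "f \<in> ?G" if "f \<in> schwartz" for f :: "real ^ 'n \<Rightarrow> complex"
  proof -
    have "foldr partial_deriv [] f \<in> ?G" using that by blast
    then show ?thesis by simp
  qed
  show "schwartz \<subseteq> coord_span ?G"
    by (rule subsetI[OF coord_span.base[OF G]])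
  show "coord_span ?G \<subseteq> schwartz"
  proof (rule coord_span_subset_schwartz)
    fix g :: "real ^ 'n \<Rightarrow> complex" assume "g \<in> ?G"
    then obtain js f where g: "g = foldr partial_deriv js f" and f: "f \<in> schwartz" by blast
    show "g differentiable (at x)" for x
      using schwartz_smooth[OF f] unfolding g smooth_def differentiable_on_def by simp
    show "partial_deriv j g \<in> coord_span ?G" for j
    proof -
      have "foldr partial_deriv (j # js) f \<in> ?G" using f by blast
      from coord_span.base[OF this] show ?thesis by (simp add: g)
    qed
    show "bounded (range (\<lambda>x. of_real (mi_power x \<alpha>) * g x))" for \<alpha>
      unfolding g by (rule schwartz_bounded_listing[OF f])
  qed
qed

lemmas schwartz_coord_spanD = equalityD1[OF schwartz_eq_coord_span, THEN subsetD]
lemmas schwartz_coord_spanI = equalityD2[OF schwartz_eq_coord_span, THEN subsetD]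

lemma schwartz_add: "f \<in> schwartz \<Longrightarrow> g \<in> schwartz \<Longrightarrow> (\<lambda>x. f x + g x) \<in> schwartz"
  by (rule schwartz_coord_spanI[OF coord_span.add[OF schwartz_coord_spanD schwartz_coord_spanD]])

lemma schwartz_scale: "f \<in> schwartz \<Longrightarrow> (\<lambda>x. k * f x) \<in> schwartz"
  by (rule schwartz_coord_spanI[OF coord_span.scale[OF schwartz_coord_spanD]])

lemma schwartz_coord: "f \<in> schwartz \<Longrightarrow> (\<lambda>x. of_real (x $ j) * f x) \<in> schwartz"
  by (rule schwartz_coord_spanI[OF coord_span.coord[OF schwartz_coord_spanD]])

lemma schwartz_diff: "f \<in> schwartz \<Longrightarrow> g \<in> schwartz \<Longrightarrow> (\<lambda>x. f x - g x) \<in> schwartz"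
  using schwartz_add[OF _ schwartz_scale[of g "-1"], of f] by simp

lemma schwartz_partial_deriv:
  assumes "f \<in> schwartz" shows "partial_deriv j f \<in> schwartz"
proof (rule schwartz_coord_spanI, rule coord_span.base)
  have "foldr partial_deriv [j] f \<in> {foldr partial_deriv js f | js f. f \<in> schwartz}"
    using assms by blast
  then show "partial_deriv j f \<in> {foldr partial_deriv js f | js f. f \<in> schwartz}" by simp
qed

lemma schwartz_bounded:
  assumes "f \<in> schwartz" obtains B where "\<And>x. norm (f x) \<le> B"
  using schwartz_bounded_listing[OF assms, of 0 "[]"]
  by (auto simp: bounded_range_iff mi_power_def)

section \<open>Integrating products of Schwartz functions\<close>

text \<open>
  An integrable function that dominates every Schwartz function up to a constant and grows at most by
  a constant factor under translations of bounded length. As a product of functions of one variable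
  it is easily integrated.
\<close>
definition cauchy_prod :: "'a::euclidean_space \<Rightarrow> real" where
  "cauchy_prod x = (\<Prod>b\<in>Basis. inverse (1 + (x \<bullet> b)\<^sup>2))"

lemma cauchy_prod_pos: "cauchy_prod x > 0"
  unfolding cauchy_prod_def by (intro prod_pos) (simp add: add_pos_nonneg)

lemma integrable_cauchy_prod: "integrable lborel (cauchy_prod :: 'a::euclidean_space \<Rightarrow> real)"
proof (rule integrableI_nonneg)
  have "integrable lborel (\<lambda>x::real. inverse (1 + x\<^sup>2))"
    using integrable_inverse_1_plus_square by (simp add: set_integrable_def)
  then have fin: "(\<integral>\<^sup>+x. ennreal (inverse (1 + x\<^sup>2)) \<partial>lborel) < \<infinity>"
    by (simp add: integrable_iff_bounded)
  have "(\<integral>\<^sup>+x. ennreal (cauchy_prod x) \<partial>(lborel :: 'a measure)) =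
      (\<integral>\<^sup>+x. (\<Prod>b\<in>Basis. ennreal (inverse (1 + (x \<bullet> b)\<^sup>2))) \<partial>(lborel :: 'a measure))"
    unfolding cauchy_prod_def by (simp add: prod_ennreal)
  also have "\<dots> = (\<Prod>b\<in>(Basis :: 'a set). \<integral>\<^sup>+x. ennreal (inverse (1 + x\<^sup>2)) \<partial>lborel)"
    by (rule nn_integral_lborel_prod) auto
  also have "\<dots> < \<infinity>"
    using fin by (simp add: power_less_top_ennreal)
  finally show "(\<integral>\<^sup>+x. ennreal (cauchy_prod x) \<partial>(lborel :: 'a measure)) < \<infinity>" .
  show "cauchy_prod \<in> borel_measurable (lborel :: 'a measure)"
    unfolding cauchy_prod_def[abs_def] by measurable
qed (simp add: less_imp_le[OF cauchy_prod_pos])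

lemma cauchy_prod_shift:
  fixes x h :: "'a::euclidean_space"
  assumes "\<And>b. b \<in> Basis \<Longrightarrow> \<bar>h \<bullet> b\<bar> \<le> 1"
  shows "cauchy_prod (x + h) \<le> 3 ^ DIM('a) * cauchy_prod x"
proof -
  have 1: "inverse (1 + (y + t)\<^sup>2) \<le> 3 * inverse (1 + y\<^sup>2)" if "\<bar>t\<bar> \<le> 1" for y t :: real
  proof -
    have "t\<^sup>2 \<le> 1" using that by (simp add: abs_square_le_1)
    moreover have "0 \<le> (y + 2 * t)\<^sup>2" by simp
    ultimately have "1 + y\<^sup>2 \<le> 3 * (1 + (y + t)\<^sup>2)"
      using zero_le_power2[of "y+t"] by (simp add: power2_eq_square algebra_simps)
    moreover have "0 < 1 + y\<^sup>2" "0 < 1 + (y + t)\<^sup>2" by (simp_all add: add_pos_nonneg)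
    ultimately show ?thesis by (simp add: field_simps)
  qed
  have "cauchy_prod (x + h) \<le> (\<Prod>b\<in>(Basis :: 'a set). 3 * inverse (1 + (x \<bullet> b)\<^sup>2))"
    unfolding cauchy_prod_def inner_add_left
    by (intro prod_mono conjI 1 assms) (simp add: add_pos_nonneg less_imp_le)
  then show ?thesis
    by (simp add: cauchy_prod_def prod.distrib)
qed

lemma schwartz_le_cauchy_prod:
  fixes f :: "real ^ 'n::finite \<Rightarrow> complex"
  assumes "f \<in> schwartz"
  obtains C where "\<And>x. norm (f x) \<le> C * cauchy_prod x"
proof -
  \<comment> \<open>multiply \<open>f\<close> by the inverse of the weight, one factor \<open>1 + x\<^sub>j\<^sup>2\<close> at a time\<close>
  have "(\<lambda>x. of_real (\<Prod>b\<in>J. 1 + (x \<bullet> b)\<^sup>2) * f x) \<in> schwartz"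
    if "finite J" "J \<subseteq> Basis" for J
    using that
  proof induction
    case (insert b J)
    then obtain j where b: "b = axis j 1" by (auto simp: Basis_vec_def)
    let ?g = "\<lambda>x. of_real (\<Prod>b\<in>J. 1 + (x \<bullet> b)\<^sup>2) * f x"
    have g: "?g \<in> schwartz" using insert by blast
    have "(\<lambda>x. ?g x + of_real (x $ j) * (of_real (x $ j) * ?g x)) \<in> schwartz"
      by (intro schwartz_add schwartz_coord g)
    also have "(\<lambda>x. ?g x + of_real (x $ j) * (of_real (x $ j) * ?g x)) =
        (\<lambda>x. of_real (\<Prod>b\<in>insert b J. 1 + (x \<bullet> b)\<^sup>2) * f x)"
      using insert by (simp add: b inner_axis fun_eq_iff power2_eq_square algebra_simps)
    finally show ?case .
  qed (use assms in simp)
  then have "(\<lambda>x. of_real (\<Prod>b\<in>Basis. 1 + (x \<bullet> b)\<^sup>2) * f x) \<in> schwartz" by simp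
  then obtain C where C: "\<And>x. norm (of_real (\<Prod>b\<in>Basis. 1 + (x \<bullet> b)\<^sup>2) * f x) \<le> C"
    using schwartz_bounded by blast
  have "norm (f x) \<le> C * cauchy_prod x" for x
  proof -
    have pos: "0 < (\<Prod>b\<in>Basis. 1 + (x \<bullet> b)\<^sup>2)" by (intro prod_pos) (simp add: add_pos_nonneg)
    then have "(\<Prod>b\<in>Basis. 1 + (x \<bullet> b)\<^sup>2) * norm (f x) \<le> C"
      using C[of x] by (simp add: norm_mult del: of_real_prod)
    moreover have "cauchy_prod x = inverse (\<Prod>b\<in>Basis. 1 + (x \<bullet> b)\<^sup>2)"
      by (simp add: cauchy_prod_def prod_inversef[symmetric] o_def)
    ultimately show ?thesis
      using pos by (simp add: field_simps)
  qed
  then show ?thesis by (rule that)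
qed

lemma schwartz_mult_le_cauchy_prod:
  fixes f g :: "real ^ 'n::finite \<Rightarrow> complex"
  assumes "f \<in> schwartz" "g \<in> schwartz"
  obtains C where "\<And>x. norm (f x * g x) \<le> C * cauchy_prod x"
proof -
  obtain B where B: "\<And>x. norm (f x) \<le> B" using schwartz_bounded[OF assms(1)] by blast
  obtain C where C: "\<And>x. norm (g x) \<le> C * cauchy_prod x"
    using schwartz_le_cauchy_prod[OF assms(2)] by blast
  have "norm (f x * g x) \<le> (B * C) * cauchy_prod x" for x
    using mult_mono[OF B C] order_trans[OF norm_ge_zero B] by (simp add: norm_mult mult.assoc)
  then show ?thesis by (rule that)
qed

lemma integrable_le_cauchy_prod:
  fixes f :: "real ^ 'n::finite \<Rightarrow> complex"
  assumes "continuous_on UNIV f" and le: "\<And>x. norm (f x) \<le> C * cauchy_prod x"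
  shows "integrable lborel f"
proof (rule Bochner_Integration.integrable_bound)
  show "integrable lborel (\<lambda>x :: real ^ 'n. C * cauchy_prod x)"
    by (simp add: integrable_cauchy_prod)
  show "f \<in> borel_measurable lborel"
    using borel_measurable_continuous_onI[OF assms(1)] by simp
  show "AE x in lborel. norm (f x) \<le> norm (C * cauchy_prod x)"
    using order_trans[OF le] by (auto intro!: AE_I2)
qed

lemma schwartz_integrable_mult:
  assumes "f \<in> schwartz" "g \<in> schwartz"
  shows "integrable lborel (\<lambda>x. f x * g x)"
proof -
  obtain C where C: "\<And>x. norm (f x * g x) \<le> C * cauchy_prod x"
    using schwartz_mult_le_cauchy_prod[OF assms] by blast
  show ?thesis
    by (rule integrable_le_cauchy_prod[OF _ C])
      (intro continuous_intros smooth_continuous schwartz_smooth assms)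
qed

lemma tendsto_difference_quotient:
  fixes f :: "real \<Rightarrow> 'a::real_normed_vector"
  assumes "(f has_vector_derivative v) (at 0)"
  shows "((\<lambda>t. (f t - f 0) /\<^sub>R t) \<longlongrightarrow> v) (at 0)"
proof -
  have "((\<lambda>t. norm (f t - f 0 - t *\<^sub>R v) / norm t) \<longlongrightarrow> 0) (at 0)"
    using assms by (simp add: has_vector_derivative_def has_derivative_iff_norm)
  then have "((\<lambda>t. norm ((f t - f 0) /\<^sub>R t - v)) \<longlongrightarrow> 0) (at 0)"
  proof (rule Lim_transform_eventually)
    show "\<forall>\<^sub>F t in at 0. norm (f t - f 0 - t *\<^sub>R v) / norm t = norm ((f t - f 0) /\<^sub>R t - v)"
      unfolding eventually_at_filter
    proof (intro always_eventually allI impI)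
      fix t :: real assume "t \<noteq> 0"
      then have "(f t - f 0) /\<^sub>R t - v = (f t - f 0 - t *\<^sub>R v) /\<^sub>R t"
        by (simp add: scaleR_diff_right)
      then show "norm (f t - f 0 - t *\<^sub>R v) / norm t = norm ((f t - f 0) /\<^sub>R t - v)"
        by (simp add: divide_inverse)
    qed
  qed
  then show ?thesis
    using Lim_null tendsto_norm_zero_iff by blast
qed

text \<open>
  The difference quotients of \<open>F\<close> in the direction \<open>e\<^sub>j\<close> have integral zero because Lebesgue measure is
  invariant under translations. By the mean value theorem they are dominated by the values of
  \<open>\<partial>\<^sub>j F\<close> at points at distance at most 1, hence by a multiple of \<^term>\<open>cauchy_prod\<close>, so the integral
  of their limit vanishes too.
\<close>
lemma integral_partial_deriv:
  fixes F :: "real ^ 'n::finite \<Rightarrow> complex"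
  assumes diff: "\<And>x. F differentiable (at x)"
    and cont: "continuous_on UNIV (partial_deriv j F)"
    and F: "integrable lborel F"
    and le: "\<And>x. norm (partial_deriv j F x) \<le> C * cauchy_prod x"
  shows "(LINT x|lborel. partial_deriv j F x) = 0"
proof -
  let ?e = "axis j 1 :: real ^ 'n"
  let ?u = "\<lambda>n. inverse (real (Suc n))"
  let ?s = "\<lambda>n x. (F (x + ?u n *\<^sub>R ?e) - F x) /\<^sub>R ?u n"
  have C: "0 \<le> C"
    using order_trans[OF norm_ge_zero le, of 0] cauchy_prod_pos[of "0 :: real ^ 'n"]
    by (simp add: zero_le_mult_iff)
  have shift: "integrable lborel (\<lambda>x. F (x + h)) \<and> (LINT x|lborel. F (x + h)) = (LINT x|lborel. F x)" for h
  proof -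
    have "F \<in> borel_measurable borel"
      by (intro borel_measurable_continuous_onI continuous_at_imp_continuous_on ballI
          differentiable_imp_continuous_within diff)
    then show ?thesis
      using integrable_distr_eq[of "(+) h" lborel borel F] integral_distr[of "(+) h" lborel borel F] F
      by (simp add: lborel_distr_plus add.commute)
  qed
  have "(\<lambda>n. integral\<^sup>L lborel (?s n)) \<longlonglongrightarrow> (LINT x|lborel. partial_deriv j F x)"
  proof (rule integral_dominated_convergence)
    show "partial_deriv j F \<in> borel_measurable lborel"
      using borel_measurable_continuous_onI[OF cont] by simp
    show "?s n \<in> borel_measurable lborel" for n
      using shift F by (intro borel_measurable_integrable) simp
    show "integrable lborel (\<lambda>x :: real ^ 'n. C * (3 ^ DIM(real ^ 'n) * cauchy_prod x))"
      by (simp add: integrable_cauchy_prod)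
    show "AE x in lborel. (\<lambda>n. ?s n x) \<longlonglongrightarrow> partial_deriv j F x"
    proof (rule AE_I2)
      fix x
      have "((\<lambda>t. F (x + t *\<^sub>R ?e)) has_vector_derivative partial_deriv j F x) (at 0)"
        using has_vector_derivative_along_axis[where t = 0, OF diff] by simp
      then have "((\<lambda>t. (F (x + t *\<^sub>R ?e) - F x) /\<^sub>R t) \<longlongrightarrow> partial_deriv j F x) (at 0)"
        by (rule tendsto_difference_quotient[where f = "\<lambda>t. F (x + t *\<^sub>R ?e)", simplified])
      moreover have "filterlim ?u (at 0) sequentially"
        using LIMSEQ_inverse_real_of_nat by (simp add: filterlim_at)
      ultimately show "(\<lambda>n. ?s n x) \<longlonglongrightarrow> partial_deriv j F x"
        by (rule filterlim_compose)
    qed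
    show "AE x in lborel. norm (?s n x) \<le> C * (3 ^ DIM(real ^ 'n) * cauchy_prod x)" for n
    proof (rule AE_I2)
      fix x
      let ?\<phi> = "\<lambda>t. F (x + t *\<^sub>R ?e)"
      have u: "0 < ?u n" "?u n \<le> 1" by (auto simp: inverse_le_1_iff)
      have \<phi>: "(?\<phi> has_vector_derivative partial_deriv j F (x + t *\<^sub>R ?e)) (at t)" for t
        by (rule has_vector_derivative_along_axis[OF diff])
      \<comment> \<open>mean value inequality on the segment from \<open>x\<close> to \<open>x + u\<^sub>n e\<^sub>j\<close>\<close>
      have "\<exists>t\<in>{0<..<?u n}. norm (?\<phi> (?u n) - ?\<phi> 0) \<le>
          norm ((?u n - 0) *\<^sub>R partial_deriv j F (x + t *\<^sub>R ?e))"
      proof (rule mvt_general[OF u(1)])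
        show "continuous_on {0..?u n} ?\<phi>"
          using has_vector_derivative_continuous[OF \<phi>] by (intro continuous_at_imp_continuous_on) blast
        show "(?\<phi> has_derivative (\<lambda>h. h *\<^sub>R partial_deriv j F (x + t *\<^sub>R ?e))) (at t)" for t
          using \<phi> unfolding has_vector_derivative_def .
      qed
      then obtain t where t: "0 < t" "t < ?u n"
        and le1: "norm (?\<phi> (?u n) - ?\<phi> 0) \<le> ?u n * norm (partial_deriv j F (x + t *\<^sub>R ?e))"
        by auto
      have "norm (?s n x) \<le> norm (partial_deriv j F (x + t *\<^sub>R ?e))"
      proof -
        have "norm (a /\<^sub>R u) \<le> c" if "norm a \<le> u * c" "0 < u" for a :: complex and u c :: real
        proof -
          have "norm (a /\<^sub>R u) = norm a / u" using that(2) by (simp add: field_simps)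
          with that show ?thesis by (simp add: pos_divide_le_eq mult.commute)
        qed
        from this[of "?\<phi> (?u n) - ?\<phi> 0", OF le1 u(1)] show ?thesis by simp
      qed
      also have "\<dots> \<le> C * cauchy_prod (x + t *\<^sub>R ?e)" by (rule le)
      also have "\<dots> \<le> C * (3 ^ DIM(real ^ 'n) * cauchy_prod x)"
      proof (intro mult_left_mono cauchy_prod_shift C)
        fix b :: "real ^ 'n" assume "b \<in> Basis"
        then have "\<bar>?e \<bullet> b\<bar> \<le> 1" by (auto simp: Basis_vec_def inner_axis_axis)
        then show "\<bar>(t *\<^sub>R ?e) \<bullet> b\<bar> \<le> 1"
          using t u by (simp add: abs_mult mult_le_one)
      qed
      finally show "norm (?s n x) \<le> C * (3 ^ DIM(real ^ 'n) * cauchy_prod x)" .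
    qed
  qed
  moreover have "integral\<^sup>L lborel (?s n) = 0" for n
    using shift F by (simp add: Bochner_Integration.integral_diff)
  ultimately show ?thesis
    using LIMSEQ_unique[OF _ tendsto_const] by force
qed

lemma schwartz_integral_by_parts:
  assumes f: "f \<in> schwartz" and g: "g \<in> schwartz"
  shows "(LINT x|lborel. partial_deriv j f x * g x) = - (LINT x|lborel. f x * partial_deriv j g x)"
proof -
  let ?f' = "partial_deriv j f" and ?g' = "partial_deriv j g"
  have f': "?f' \<in> schwartz" and g': "?g' \<in> schwartz"
    using f g schwartz_partial_deriv by blast+
  have eq: "partial_deriv j (\<lambda>x. f x * g x) = (\<lambda>x. f x * ?g' x + ?f' x * g x)"
    by (intro ext partial_deriv_mult schwartz_differentiable f g)
  obtain C1 where C1: "\<And>x. norm (f x * ?g' x) \<le> C1 * cauchy_prod x"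
    using schwartz_mult_le_cauchy_prod[OF f g'] by blast
  obtain C2 where C2: "\<And>x. norm (?f' x * g x) \<le> C2 * cauchy_prod x"
    using schwartz_mult_le_cauchy_prod[OF f' g] by blast
  have "(LINT x|lborel. partial_deriv j (\<lambda>x. f x * g x) x) = 0"
  proof (rule integral_partial_deriv)
    show "(\<lambda>x. f x * g x) differentiable at x" for x
      by (intro differentiable_mult schwartz_differentiable f g)
    show "continuous_on UNIV (partial_deriv j (\<lambda>x. f x * g x))"
      unfolding eq by (intro continuous_intros smooth_continuous schwartz_smooth f g f' g')
    show "integrable lborel (\<lambda>x. f x * g x)"
      by (rule schwartz_integrable_mult[OF f g])
    show "norm (partial_deriv j (\<lambda>x. f x * g x) x) \<le> (C1 + C2) * cauchy_prod x" for x
      unfolding eq distrib_right by (rule norm_triangle_le[OF add_mono[OF C1 C2]])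
  qed
  then show ?thesis
    unfolding eq
    using schwartz_integrable_mult[OF f g'] schwartz_integrable_mult[OF f' g]
    by (simp add: add_eq_0_iff)
qed

section \<open>Creation and annihilation operators\<close>

text \<open>
  The creation and annihilation operators of the harmonic oscillator, without the usual factor
  \<open>1 / \<surd>2\<close>.
\<close>
definition raise :: "'n \<Rightarrow> (real ^ 'n::finite \<Rightarrow> complex) \<Rightarrow> real ^ 'n \<Rightarrow> complex" where
  "raise j f x = of_real (x $ j) * f x - partial_deriv j f x"

definition lower :: "'n \<Rightarrow> (real ^ 'n::finite \<Rightarrow> complex) \<Rightarrow> real ^ 'n \<Rightarrow> complex" where
  "lower j f x = of_real (x $ j) * f x + partial_deriv j f x"

lemma schwartz_raise: "f \<in> schwartz \<Longrightarrow> raise j f \<in> schwartz"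
  unfolding raise_def[abs_def] by (intro schwartz_diff schwartz_coord schwartz_partial_deriv)

lemma schwartz_lower: "f \<in> schwartz \<Longrightarrow> lower j f \<in> schwartz"
  unfolding lower_def[abs_def] by (intro schwartz_add schwartz_coord schwartz_partial_deriv)

lemma raise_scale: "f \<in> schwartz \<Longrightarrow> raise j (\<lambda>x. k * f x) = (\<lambda>x. k * raise j f x)"
  by (simp add: raise_def partial_deriv_cmult schwartz_differentiable fun_eq_iff algebra_simps)

lemma lower_scale: "f \<in> schwartz \<Longrightarrow> lower j (\<lambda>x. k * f x) = (\<lambda>x. k * lower j f x)"
  by (simp add: lower_def partial_deriv_cmult schwartz_differentiable fun_eq_iff algebra_simps)

lemma partial_deriv_raise:
  assumes "f \<in> schwartz"
  shows "partial_deriv i (raise j f) x = of_real (x $ j) * partial_deriv i f x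
    - partial_deriv i (partial_deriv j f) x + (if i = j then f x else 0)"
proof -
  have "raise j f = (\<lambda>x. of_real (x $ j) * f x + (-1) * partial_deriv j f x)"
    by (simp add: raise_def fun_eq_iff)
  moreover have "(\<lambda>x. -1 * partial_deriv j f x) differentiable at x"
    using assms by (intro schwartz_differentiable schwartz_scale schwartz_partial_deriv)
  moreover have "(\<lambda>x. of_real (x $ j) * f x) differentiable at x"
    using assms by (intro schwartz_differentiable schwartz_coord)
  ultimately have "partial_deriv i (raise j f) x =
      partial_deriv i (\<lambda>x. of_real (x $ j) * f x) x + partial_deriv i (\<lambda>x. -1 * partial_deriv j f x) x"
    by (simp only: partial_deriv_add)
  also have "partial_deriv i (\<lambda>x. -1 * partial_deriv j f x) x = -1 * partial_deriv i (partial_deriv j f) x"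
    using assms by (intro partial_deriv_cmult schwartz_differentiable schwartz_partial_deriv)
  also have "partial_deriv i (\<lambda>x. of_real (x $ j) * f x) x =
      of_real (x $ j) * partial_deriv i f x + (if i = j then f x else 0)"
    using assms by (intro partial_deriv_coord_mult schwartz_differentiable)
  finally show ?thesis by simp
qed

lemma partial_deriv_lower:
  assumes "f \<in> schwartz"
  shows "partial_deriv i (lower j f) x = of_real (x $ j) * partial_deriv i f x
    + partial_deriv i (partial_deriv j f) x + (if i = j then f x else 0)"
proof -
  have "lower j f = (\<lambda>x. of_real (x $ j) * f x + partial_deriv j f x)"
    by (simp add: lower_def fun_eq_iff)
  moreover have "partial_deriv j f differentiable at x"
    using assms by (intro schwartz_differentiable schwartz_scale schwartz_partial_deriv)
  moreover have "(\<lambda>x. of_real (x $ j) * f x) differentiable at x"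
    using assms by (intro schwartz_differentiable schwartz_coord)
  ultimately have "partial_deriv i (lower j f) x =
      partial_deriv i (\<lambda>x. of_real (x $ j) * f x) x + partial_deriv i (partial_deriv j f) x"
    by (simp only: partial_deriv_add)
  also have "partial_deriv i (\<lambda>x. of_real (x $ j) * f x) x =
      of_real (x $ j) * partial_deriv i f x + (if i = j then f x else 0)"
    using assms by (intro partial_deriv_coord_mult schwartz_differentiable)
  finally show ?thesis by simp
qed

lemma raise_commute:
  assumes "f \<in> schwartz" shows "raise i (raise j f) = raise j (raise i f)"
proof
  fix x
  show "raise i (raise j f) x = raise j (raise i f) x"
    unfolding raise_def[of i "raise j f"] raise_def[of j "raise i f"] partial_deriv_raise[OF assms]
      partial_deriv_commute[OF schwartz_smooth[OF assms], of i j]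
    by (simp add: raise_def algebra_simps)
qed

text \<open>
  The canonical commutation relation \<open>[A\<^sub>i, A\<^sub>j\<^sup>*] = 2 \<delta>\<^sub>i\<^sub>j\<close>; \<open>\<partial>\<^sub>i\<close> acting on
  \<open>x\<^sub>j\<close> contributes \<open>\<delta>\<^sub>i\<^sub>j\<close> to the left-hand side, and \<open>- \<partial>\<^sub>j\<close> acting on \<open>x\<^sub>i\<close> contributes \<open>- \<delta>\<^sub>i\<^sub>j\<close> to the
  first summand on the right.
\<close>
lemma lower_raise:
  assumes "f \<in> schwartz"
  shows "lower i (raise j f) = (\<lambda>x. raise j (lower i f) x + (if i = j then 2 else 0) * f x)"
proof
  fix x
  show "lower i (raise j f) x = raise j (lower i f) x + (if i = j then 2 else 0) * f x"
    unfolding lower_def[of i "raise j f"] raise_def[of j "lower i f"] partial_deriv_raise[OF assms]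
      partial_deriv_lower[OF assms] partial_deriv_commute[OF schwartz_smooth[OF assms], of i j]
    by (simp add: raise_def lower_def algebra_simps)
qed

section \<open>The Gaussian and its excitations\<close>

definition gauss :: "real ^ 'n::finite \<Rightarrow> complex" where
  "gauss x = of_real (exp (- (norm x)\<^sup>2 / 2))"

lemma has_derivative_exp_norm_sq:
  "((\<lambda>x::real ^ 'n::finite. exp (c * (norm x)\<^sup>2)) has_derivative
    (\<lambda>h. 2 * c * (x \<bullet> h) * exp (c * (norm x)\<^sup>2))) (at x)"
  unfolding power2_norm_eq_inner
  by (auto intro!: derivative_eq_intros simp: inner_commute algebra_simps)

lemma partial_deriv_exp_norm_sq:
  "partial_deriv j (\<lambda>x. exp (c * (norm x)\<^sup>2)) x = 2 * c * (x $ j) * exp (c * (norm x)\<^sup>2)"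
  by (simp add: partial_deriv_eq[OF has_derivative_exp_norm_sq] inner_axis)

lemma gauss_has_derivative:
  "(gauss has_derivative (\<lambda>h. of_real (- (x \<bullet> h) * exp (- (norm x)\<^sup>2 / 2)))) (at x)"
  unfolding gauss_def[abs_def]
  using has_derivative_of_real[OF has_derivative_exp_norm_sq[of "-1/2" x]] by simp

lemma partial_deriv_gauss: "partial_deriv j gauss = (\<lambda>x. -1 * (of_real (x $ j) * gauss x))"
  by (simp add: partial_deriv_eq[OF gauss_has_derivative] inner_axis gauss_def fun_eq_iff)

lemma abs_mi_power_le: "\<bar>mi_power x \<alpha>\<bar> \<le> norm x ^ mi_size \<alpha>"
proof -
  have "\<bar>mi_power x \<alpha>\<bar> = (\<Prod>j\<in>UNIV. \<bar>x $ j\<bar> ^ (\<alpha> $ j))"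
    by (simp add: mi_power_def abs_prod power_abs)
  also have "\<dots> \<le> (\<Prod>j\<in>UNIV. norm x ^ (\<alpha> $ j))"
    by (intro prod_mono conjI power_mono component_le_norm_cart) auto
  finally show ?thesis by (simp add: mi_size_def power_sum)
qed

lemma exp_gt_self: "x < exp x" for x :: real
  using exp_ge_add_one_self[of x] by linarith

text \<open>
  For \<open>t \<ge> 1\<close> and \<open>n > 0\<close>, raising \<open>t\<^sup>2 / (2 n) \<le> exp (t\<^sup>2 / (2 n))\<close> to the power \<open>n\<close> bounds even
  \<open>t\<^bsup>2n\<^esup>\<close>; the summand 1 takes care of \<open>t \<le> 1\<close>.
\<close>
lemma power_times_gauss_le: "t ^ n * exp (- t\<^sup>2 / 2) \<le> 1 + (2 * real n) ^ n" if "0 \<le> t" for t :: real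
proof (cases "t \<le> 1")
  case True
  then have "t ^ n * exp (- t\<^sup>2 / 2) \<le> 1 * 1"
    using that by (intro mult_mono power_le_one) auto
  then show ?thesis by (simp add: add_increasing2)
next
  case False
  show ?thesis
  proof (cases "n = 0")
    case False
    have "(t\<^sup>2 / 2 / n) ^ n \<le> exp (t\<^sup>2 / 2 / n) ^ n"
      using less_imp_le[OF exp_gt_self[of "t\<^sup>2 / 2 / n"]] by (intro power_mono; simp)
    also have "\<dots> = exp (t\<^sup>2 / 2)" using False by (simp flip: exp_of_nat_mult)
    finally have "(t\<^sup>2) ^ n \<le> (2 * real n) ^ n * exp (t\<^sup>2 / 2)"
      using False by (simp add: power_divide power_mult_distrib field_simps)
    moreover have "t ^ n \<le> (t\<^sup>2) ^ n"
      using \<open>\<not> t \<le> 1\<close> by (intro power_mono) (auto simp: power2_eq_square)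
    ultimately have "t ^ n \<le> (2 * real n) ^ n * exp (t\<^sup>2 / 2)" by linarith
    then have "t ^ n * exp (- t\<^sup>2 / 2) \<le> (2 * real n) ^ n"
      by (simp add: exp_minus field_simps)
    then show ?thesis by simp
  next
    case True
    moreover have "exp (- (t\<^sup>2 / 2)) \<le> 2" by (rule order_trans[of _ 1]) simp_all
    ultimately show ?thesis by simp
  qed
qed

lemma coord_span_gauss_subset: "coord_span {gauss} \<subseteq> schwartz"
proof (rule coord_span_subset_schwartz)
  fix g :: "real ^ 'n \<Rightarrow> complex" assume "g \<in> {gauss}"
  then have g: "g = gauss" by simp
  show "g differentiable (at x)" for x
    using gauss_has_derivative unfolding g differentiable_def by blast
  show "partial_deriv j g \<in> coord_span {gauss}" for j
    unfolding g partial_deriv_gauss by (intro coord_span.scale coord_span.coord coord_span.base) simp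
  have "norm (of_real (mi_power x \<alpha>) * gauss x) \<le> 1 + (2 * real (mi_size \<alpha>)) ^ mi_size \<alpha>" for x :: "real ^ 'n" and \<alpha>
  proof -
    have "norm (of_real (mi_power x \<alpha>) * gauss x) \<le> norm x ^ mi_size \<alpha> * exp (- (norm x)\<^sup>2 / 2)"
      using abs_mi_power_le by (simp add: gauss_def norm_mult mult_right_mono)
    also have "\<dots> \<le> 1 + (2 * real (mi_size \<alpha>)) ^ mi_size \<alpha>"
      by (rule power_times_gauss_le) simp
    finally show ?thesis .
  qed
  then show "bounded (range (\<lambda>x. of_real (mi_power x \<alpha>) * g x))" for \<alpha>
    unfolding g bounded_range_iff by blast
qed

lemma schwartz_gauss: "gauss \<in> schwartz"
  using coord_span_gauss_subset coord_span.base by blast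

abbreviation excited :: "'n list \<Rightarrow> real ^ 'n::finite \<Rightarrow> complex" where
  "excited js \<equiv> foldr raise js gauss"

lemma schwartz_excited: "excited js \<in> schwartz"
  by (induction js) (auto intro: schwartz_raise schwartz_gauss)

lemma excited_permute: "mset xs = mset ys \<Longrightarrow> excited xs = excited ys"
  by (rule foldr_commuting_permute[where K = schwartz])
    (auto intro: schwartz_raise schwartz_gauss raise_commute)

lemma lower_gauss: "lower j gauss = (\<lambda>x. 0)"
  by (simp add: lower_def partial_deriv_gauss fun_eq_iff)

text \<open>
  Commuting the annihilation operator to the right through the creation operators picks up 2 for every
  occurrence of its index, and at the end it kills the Gaussian.
\<close>
lemma lower_excited:
  "lower i (excited js) = (\<lambda>x. 2 * of_nat (count_list js i) * excited (remove1 i js) x)"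
proof (induction js)
  case Nil
  then show ?case by (simp add: lower_gauss)
next
  case (Cons j js)
  have "lower i (excited (j # js)) =
      (\<lambda>x. 2 * of_nat (count_list js i) * excited (j # remove1 i js) x
         + (if i = j then 2 else 0) * excited js x)"
    by (simp add: lower_raise schwartz_excited Cons raise_scale)
  also have "\<dots> = (\<lambda>x. 2 * of_nat (count_list (j # js) i) * excited (remove1 i (j # js)) x)"
  proof (cases "i = j")
    case True
    show ?thesis
    proof (cases "j \<in> set js")
      case True
      then have "excited (j # remove1 j js) = excited js"
        by (intro excited_permute) simp
      with \<open>i = j\<close> show ?thesis by (simp only: if_True) (simp add: algebra_simps)
    next
      case False
      with \<open>i = j\<close> show ?thesis by (simp add: count_list_0_iff)
    qed
  qed auto
  finally show ?case .
qed

text \<open>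
  Conjugation by the function \<open>exp (- |x|\<^sup>2 / 2)\<close> turns \<open>\<partial>\<^sub>j\<close> into \<open>\<partial>\<^sub>j - x\<^sub>j\<close>, the negative of the
  creation operator. The vanishing imaginary part is carried along because the Hermite functions are
  defined by real derivatives, whereas the creation operators act on complex functions.
\<close>

lemma iterated_deriv_gaussian:
  "(\<forall>x. Im (excited js x) = 0) \<and>
   foldr partial_deriv js (\<lambda>y. exp (- (norm y)\<^sup>2)) =
     (\<lambda>x. (-1) ^ length js * (Re (excited js x) * exp (- 1 / 2 * (norm x)\<^sup>2)))"
proof (induction js)
  case Nil
  have "exp (- (norm x)\<^sup>2) = exp (- (norm x)\<^sup>2 / 2) * exp (- 1 / 2 * (norm x)\<^sup>2)" for x :: "real ^ 'a"
    by (simp flip: exp_add)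
  then show ?case by (simp add: gauss_def)
next
  case (Cons j js)
  let ?U = "excited js" and ?E = "\<lambda>x. exp (- 1 / 2 * (norm x)\<^sup>2)"
  have U: "?U differentiable at x" for x
    by (intro schwartz_differentiable schwartz_excited)
  have "partial_deriv j (\<lambda>x. Im (?U x)) x = Im (partial_deriv j ?U x)" for x
    by (rule partial_deriv_bounded_linear[OF bounded_linear_Im U])
  then have "Im (partial_deriv j ?U x) = 0" for x
    using Cons by (simp add: partial_deriv_def)
  then have Im: "\<forall>x. Im (excited (j # js) x) = 0"
    using Cons by (simp add: raise_def[of j "?U"])
  have Re: "partial_deriv j (\<lambda>x. Re (?U x)) x = Re (partial_deriv j ?U x)" for x
    by (rule partial_deriv_bounded_linear[OF bounded_linear_Re U])
  have dR: "(\<lambda>x. Re (?U x)) differentiable at x" for x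
    using U[of x] bounded_linear.has_derivative[OF bounded_linear_Re] unfolding differentiable_def by blast
  have dE: "?E differentiable at x" for x :: "real ^ 'a"
    using has_derivative_exp_norm_sq unfolding differentiable_def by blast
  have "partial_deriv j (\<lambda>x. (-1) ^ length js * (Re (?U x) * ?E x)) x =
      (-1) ^ length js * (Re (?U x) * partial_deriv j ?E x + partial_deriv j (\<lambda>x. Re (?U x)) x * ?E x)" for x
    by (subst partial_deriv_cmult, intro differentiable_mult dR dE)
      (simp only: partial_deriv_mult[OF dR dE])
  also have "\<dots> x = (-1) ^ length (j # js) * (Re (excited (j # js) x) * ?E x)" for x
    unfolding Re partial_deriv_exp_norm_sq by (simp add: raise_def[of j "?U"] algebra_simps)
  finally have step: "partial_deriv j (\<lambda>x. (-1) ^ length js * (Re (?U x) * ?E x)) =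
      (\<lambda>x. (-1) ^ length (j # js) * (Re (excited (j # js) x) * ?E x))" ..
  have "foldr partial_deriv (j # js) (\<lambda>y. exp (- (norm y)\<^sup>2)) =
      partial_deriv j (foldr partial_deriv js (\<lambda>y. exp (- (norm y)\<^sup>2)))"
    by simp
  with Im Cons step show ?case by metis
qed

definition hermite_const :: "'n::finite multi_index \<Rightarrow> real" where
  "hermite_const \<alpha> = pi powr (- real CARD('n) / 4) * (2 ^ mi_size \<alpha> * mi_fact \<alpha>) powr (- 1 / 2)"

abbreviation hermite :: "'n::finite multi_index \<Rightarrow> real ^ 'n \<Rightarrow> complex" where
  "hermite \<alpha> \<equiv> \<lambda>x. of_real (hermite_fun \<alpha> x)"

lemma length_mi_listing: "length (mi_listing \<alpha>) = mi_size \<alpha>"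
  using sum_count_set[of "mi_listing \<alpha>" UNIV] by (simp add: count_list_mi_listing mi_size_def)

lemma hermite_eq_excited:
  "hermite \<alpha> = (\<lambda>x. of_real (hermite_const \<alpha>) * excited (mi_listing \<alpha>) x)"
proof
  fix x
  let ?U = "excited (mi_listing \<alpha>)"
  have "of_real (Re (?U x)) = ?U x"
    using iterated_deriv_gaussian[of "mi_listing \<alpha>"] by (simp add: complex_eq_iff)
  moreover have "hermite_fun \<alpha> x = hermite_const \<alpha> *
      (((-1) ^ mi_size \<alpha> * (-1) ^ mi_size \<alpha>) * (exp ((norm x)\<^sup>2 / 2) * exp (- 1 / 2 * (norm x)\<^sup>2))) * Re (?U x)"
    using iterated_deriv_gaussian[of "mi_listing \<alpha>"]
    by (simp add: hermite_fun_def hermite_const_def mi_iterate_def length_mi_listing)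
  moreover have "(-1) ^ mi_size \<alpha> * (-1) ^ mi_size \<alpha> = (1 :: real)"
    by (simp flip: power_mult_distrib)
  moreover have "exp ((norm x)\<^sup>2 / 2) * exp (- 1 / 2 * (norm x)\<^sup>2) = 1"
    by (simp flip: exp_add)
  ultimately show "hermite \<alpha> x = of_real (hermite_const \<alpha>) * ?U x" by simp
qed

lemma schwartz_hermite: "hermite \<alpha> \<in> schwartz"
  unfolding hermite_eq_excited by (intro schwartz_scale schwartz_excited)

lemma hermite_const_pos: "hermite_const \<alpha> > 0"
  unfolding hermite_const_def mi_fact_def by (simp add: prod_pos)

lemma mi_size_add_axis: "mi_size (\<alpha> + axis j 1) = Suc (mi_size \<alpha>)"
  by (simp add: mi_size_def sum.distrib axis_def)

lemma mi_fact_add_axis: "mi_fact (\<alpha> + axis j 1) = real (Suc (\<alpha> $ j)) * mi_fact \<alpha>"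
proof -
  have "mi_fact (\<alpha> + axis j 1) = (\<Prod>i\<in>UNIV. (if i = j then real (Suc (\<alpha> $ j)) else 1) * fact (\<alpha> $ i))"
    unfolding mi_fact_def by (intro prod.cong) (auto simp: axis_def)
  then show ?thesis by (simp add: prod.distrib mi_fact_def)
qed

text \<open>
  The normalization of the Hermite functions is what makes the ladder relations below symmetric: the
  factor \<open>2 (\<alpha>\<^sub>j + 1)\<close> by which the squared constants of neighbours differ is shared equally between
  raising and lowering.
\<close>
lemma hermite_const_add_axis:
  "hermite_const (\<alpha> + axis j 1) * sqrt (2 * real (Suc (\<alpha> $ j))) = hermite_const \<alpha>"
proof -
  let ?t = "2 * real (Suc (\<alpha> $ j))"
  have "2 ^ mi_size (\<alpha> + axis j 1) * mi_fact (\<alpha> + axis j 1) = (2 ^ mi_size \<alpha> * mi_fact \<alpha>) * ?t"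
    unfolding mi_size_add_axis mi_fact_add_axis by simp
  then have "hermite_const (\<alpha> + axis j 1) = hermite_const \<alpha> * ?t powr (- 1 / 2)"
    unfolding hermite_const_def mi_fact_def by (simp add: powr_mult prod_nonneg)
  moreover have "?t powr (- 1 / 2) * sqrt ?t = 1"
    by (simp add: powr_minus powr_half_sqrt del: of_nat_Suc)
  ultimately show ?thesis by simp
qed

lemma raise_hermite:
  "raise j (hermite \<alpha>) = (\<lambda>x. of_real (sqrt (2 * real (Suc (\<alpha> $ j)))) * hermite (\<alpha> + axis j 1) x)"
proof -
  have "excited (j # mi_listing \<alpha>) = excited (mi_listing (\<alpha> + axis j 1))"
    by (intro excited_permute, unfold mset_eq_iff_count_list)
      (auto simp: count_list_mi_listing axis_def)
  then have "raise j (hermite \<alpha>) = (\<lambda>x. of_real (hermite_const \<alpha>) * excited (mi_listing (\<alpha> + axis j 1)) x)"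
    unfolding hermite_eq_excited by (simp add: raise_scale schwartz_excited)
  then show ?thesis
    unfolding fun_cong[OF hermite_eq_excited[of "\<alpha> + axis j 1"]] hermite_const_add_axis[of \<alpha> j, symmetric]
    by (simp add: mult_ac)
qed

lemma lower_hermite:
  "lower j (hermite \<alpha>) = (\<lambda>x. of_real (sqrt (2 * real (\<alpha> $ j))) * hermite (\<alpha> - axis j 1) x)"
proof (cases "\<alpha> $ j = 0")
  case True
  then show ?thesis
    unfolding hermite_eq_excited
    by (simp add: lower_scale schwartz_excited lower_excited count_list_mi_listing)
next
  case False
  let ?\<beta> = "\<alpha> - axis j 1" and ?t = "2 * real (\<alpha> $ j)"
  have \<alpha>: "\<alpha> = ?\<beta> + axis j 1"
    using False by (auto simp: vec_eq_iff axis_def)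
  have \<beta>: "Suc (?\<beta> $ j) = \<alpha> $ j"
    using False by (simp add: axis_def)
  have "mset (remove1 j (mi_listing \<alpha>)) = mset (mi_listing ?\<beta>)"
    by (auto simp: multiset_eq_iff count_mset count_list_mi_listing axis_def)
  then have "excited (remove1 j (mi_listing \<alpha>)) = excited (mi_listing ?\<beta>)"
    by (rule excited_permute)
  then have "lower j (hermite \<alpha>) = (\<lambda>x. of_real (hermite_const \<alpha> * ?t) * excited (mi_listing ?\<beta>) x)"
    unfolding hermite_eq_excited
    by (simp add: lower_scale schwartz_excited lower_excited count_list_mi_listing mult_ac)
  moreover have "hermite_const \<alpha> * ?t = sqrt ?t * hermite_const ?\<beta>"
  proof -
    have "sqrt ?t * (hermite_const \<alpha> * sqrt ?t) = sqrt ?t * hermite_const ?\<beta>"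
      using hermite_const_add_axis[of ?\<beta> j] unfolding \<alpha>[symmetric] \<beta> by simp
    moreover have "sqrt ?t * (hermite_const \<alpha> * sqrt ?t) = hermite_const \<alpha> * (sqrt ?t * sqrt ?t)"
      by (simp only: mult_ac)
    ultimately show ?thesis by simp
  qed
  ultimately show ?thesis
    unfolding fun_cong[OF hermite_eq_excited[of ?\<beta>]] by (simp add: mult_ac)
qed

section \<open>Ladder operators on formal series\<close>

text \<open>
  The action of the ladder operators on Hermite coefficients, normalized so that multiplication by
  \<open>x\<^sub>j\<close> becomes \<open>down j + up j\<close> and \<open>\<partial>\<^sub>j\<close> becomes \<open>down j - up j\<close>. For \<open>\<alpha>\<^sub>j = 0\<close> the difference
  \<open>\<alpha> - e\<^sub>j\<close> is truncated to \<open>\<alpha>\<close>, which is harmless since the factor in front of it is zero.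
\<close>
definition up :: "'n \<Rightarrow> 'n::finite formal_series \<Rightarrow> 'n formal_series" where
  "up j c \<alpha> = of_real (sqrt (real (\<alpha> $ j) / 2)) * c (\<alpha> - axis j 1)"

definition down :: "'n \<Rightarrow> 'n::finite formal_series \<Rightarrow> 'n formal_series" where
  "down j c \<alpha> = of_real (sqrt (real (Suc (\<alpha> $ j)) / 2)) * c (\<alpha> + axis j 1)"

text \<open>
  The algebra of operators on formal series generated by the ladder operators. It is closed under
  composition; generating it by composing with single ladder operators from the left makes inductions
  short.
\<close>
inductive_set ladder_algebra :: "('n::finite formal_series \<Rightarrow> 'n formal_series) set" where
  ident: "(\<lambda>c. c) \<in> ladder_algebra"
| up: "T \<in> ladder_algebra \<Longrightarrow> (\<lambda>c. up j (T c)) \<in> ladder_algebra"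
| down: "T \<in> ladder_algebra \<Longrightarrow> (\<lambda>c. down j (T c)) \<in> ladder_algebra"
| add: "T \<in> ladder_algebra \<Longrightarrow> U \<in> ladder_algebra \<Longrightarrow> (\<lambda>c \<alpha>. T c \<alpha> + U c \<alpha>) \<in> ladder_algebra"
| scale: "T \<in> ladder_algebra \<Longrightarrow> (\<lambda>c \<alpha>. k * T c \<alpha>) \<in> ladder_algebra"

lemma linear_up: "linear_operator (up j)"
  by (simp add: linear_operator_def up_def fun_eq_iff algebra_simps)

lemma linear_down: "linear_operator (down j)"
  by (simp add: linear_operator_def down_def fun_eq_iff algebra_simps)

lemma linear_compose:
  "linear_operator T \<Longrightarrow> linear_operator U \<Longrightarrow> linear_operator (\<lambda>c. T (U c))"
  by (simp add: linear_operator_def)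

lemma linear_ladder_algebra: "T \<in> ladder_algebra \<Longrightarrow> linear_operator T"
proof (induction rule: ladder_algebra.induct)
  case ident
  then show ?case by (simp add: linear_operator_def)
next
  case (up T j)
  then show ?case using linear_compose[OF linear_up] by blast
next
  case (down T j)
  then show ?case using linear_compose[OF linear_down] by blast
next
  case (add T U)
  then show ?case by (simp add: linear_operator_def fun_eq_iff algebra_simps)
next
  case (scale T k)
  then show ?case by (simp add: linear_operator_def fun_eq_iff algebra_simps)
qed

lemma formal_topology_eq: "formal_topology = euclidean"
  unfolding formal_topology_def by (rule euclidean_product_topology)

lemma continuous_formal_iff:
  "continuous_map formal_topology formal_topology T \<longleftrightarrow> (\<forall>\<alpha>. continuous_on UNIV (\<lambda>c. T c \<alpha>))"
  by (auto simp: formal_topology_eq intro: continuous_on_product_then_coordinatewise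
      continuous_on_coordinatewise_then_product)

lemma continuous_formal_ladder_algebra:
  assumes "T \<in> ladder_algebra"
  shows "continuous_map formal_topology formal_topology T"
  unfolding continuous_formal_iff
  using assms
proof (induction rule: ladder_algebra.induct)
  case (up T j)
  then show ?case by (simp add: up_def continuous_on_mult_left)
next
  case (down T j)
  then show ?case by (simp add: down_def continuous_on_mult_left)
qed (simp_all add: continuous_on_add continuous_on_mult_left)

section \<open>Bounded operators for a directed family of seminorms\<close>

definition subspace_of_series :: "'n::finite formal_series set \<Rightarrow> bool" where
  "subspace_of_series E \<longleftrightarrow> (\<lambda>\<alpha>. 0) \<in> E \<and>
     (\<forall>c\<in>E. \<forall>d\<in>E. (\<lambda>\<alpha>. c \<alpha> + d \<alpha>) \<in> E) \<and> (\<forall>k. \<forall>c\<in>E. (\<lambda>\<alpha>. k * c \<alpha>) \<in> E)"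

text \<open>
  The usual continuity estimate for operators between locally convex spaces. A single seminorm \<open>q\<close>
  suffices on the right-hand side because the families considered below are directed.
\<close>
definition bounded_operator ::
  "'n::finite formal_series set \<Rightarrow> ('n formal_series \<Rightarrow> real) set \<Rightarrow>
   ('n formal_series \<Rightarrow> 'n formal_series) \<Rightarrow> bool" where
  "bounded_operator E P T \<longleftrightarrow> (\<forall>c\<in>E. T c \<in> E) \<and>
     (\<forall>p\<in>P. \<exists>q\<in>P. \<exists>C\<ge>0. \<forall>c\<in>E. p (T c) \<le> C * q c)"

locale directed_seminorms =
  fixes E :: "'n::finite formal_series set" and P :: "('n formal_series \<Rightarrow> real) set"
  assumes subspace: "subspace_of_series E"
    and nonempty: "P \<noteq> {}"
    and seminorm: "p \<in> P \<Longrightarrow> seminorm_on E p"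
    and directed: "p \<in> P \<Longrightarrow> q \<in> P \<Longrightarrow> \<exists>r\<in>P. \<forall>c\<in>E. p c \<le> r c \<and> q c \<le> r c"
begin

lemma zero_mem: "(\<lambda>\<alpha>. 0) \<in> E"
  and add_mem: "c \<in> E \<Longrightarrow> d \<in> E \<Longrightarrow> (\<lambda>\<alpha>. c \<alpha> + d \<alpha>) \<in> E"
  and scale_mem: "c \<in> E \<Longrightarrow> (\<lambda>\<alpha>. k * c \<alpha>) \<in> E"
  using subspace by (simp_all add: subspace_of_series_def)

lemma diff_mem: "c \<in> E \<Longrightarrow> d \<in> E \<Longrightarrow> (\<lambda>\<alpha>. c \<alpha> - d \<alpha>) \<in> E"
  using add_mem[OF _ scale_mem[of d "-1"], of c] by simp

lemma seminorm_add: "p \<in> P \<Longrightarrow> c \<in> E \<Longrightarrow> d \<in> E \<Longrightarrow> p (\<lambda>\<alpha>. c \<alpha> + d \<alpha>) \<le> p c + p d"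
  and seminorm_scale: "p \<in> P \<Longrightarrow> c \<in> E \<Longrightarrow> p (\<lambda>\<alpha>. k * c \<alpha>) = cmod k * p c"
  using seminorm unfolding seminorm_on_def by blast+

lemma seminorm_zero: "p \<in> P \<Longrightarrow> p (\<lambda>\<alpha>. 0) = 0"
  using seminorm_scale[OF _ zero_mem, of p 0] by simp

lemma topspace_eq: "topspace (seminorm_topology E P) = E"
  using nonempty seminorm_zero topspace_seminorm_topology by blast

lemma ball_open:
  assumes "p \<in> P" "c \<in> E" "0 < \<epsilon>"
  shows "openin (seminorm_topology E P) {d \<in> E. p (\<lambda>\<alpha>. d \<alpha> - c \<alpha>) < \<epsilon>}"
  unfolding seminorm_topology_def using assms by (intro topology_generated_by_Basis) blast

lemma bounded_operator_continuous:
  assumes lin: "linear_operator T" and bdd: "bounded_operator E P T"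
  shows "continuous_map (seminorm_topology E P) (seminorm_topology E P) T"
proof -
  let ?X = "seminorm_topology E P"
  have mem: "T c \<in> E" if "c \<in> E" for c
    using bdd that by (simp add: bounded_operator_def)
  have sub: "T (\<lambda>\<alpha>. c \<alpha> - d \<alpha>) = (\<lambda>\<alpha>. T c \<alpha> - T d \<alpha>)" for c d
  proof -
    have "T (\<lambda>\<alpha>. c \<alpha> + (-1) * d \<alpha>) = (\<lambda>\<alpha>. T c \<alpha> + (-1) * T d \<alpha>)"
      using lin unfolding linear_operator_def by metis
    then show ?thesis by simp
  qed
  have "openin ?X (T -` {d \<in> E. p (\<lambda>\<alpha>. d \<alpha> - c \<alpha>) < \<epsilon>} \<inter> E)" (is "openin ?X ?V")
    if p: "p \<in> P" and c: "c \<in> E" for p c \<epsilon>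
  proof (subst openin_subopen, intro ballI)
    obtain q C where q: "q \<in> P" and C: "0 \<le> C" and le: "\<And>c. c \<in> E \<Longrightarrow> p (T c) \<le> C * q c"
      using bdd p unfolding bounded_operator_def by blast
    fix d assume "d \<in> ?V"
    then have d: "d \<in> E" and pd: "p (\<lambda>\<alpha>. T d \<alpha> - c \<alpha>) < \<epsilon>" by auto
    \<comment> \<open>\<open>C + 1\<close> instead of \<open>C\<close>, which may be zero\<close>
    define \<delta> where "\<delta> = (\<epsilon> - p (\<lambda>\<alpha>. T d \<alpha> - c \<alpha>)) / (C + 1)"
    have \<delta>: "0 < \<delta>" using pd C by (simp add: \<delta>_def)
    let ?B = "{e \<in> E. q (\<lambda>\<alpha>. e \<alpha> - d \<alpha>) < \<delta>}"
    have "e \<in> ?V" if e: "e \<in> ?B" for e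
    proof -
      have eE: "e \<in> E" and qe: "q (\<lambda>\<alpha>. e \<alpha> - d \<alpha>) < \<delta>" using e by auto
      have "p (\<lambda>\<alpha>. T e \<alpha> - c \<alpha>) = p (\<lambda>\<alpha>. (T e \<alpha> - T d \<alpha>) + (T d \<alpha> - c \<alpha>))" by simp
      also have "\<dots> \<le> p (\<lambda>\<alpha>. T e \<alpha> - T d \<alpha>) + p (\<lambda>\<alpha>. T d \<alpha> - c \<alpha>)"
        by (intro seminorm_add p diff_mem mem eE d c)
      also have "p (\<lambda>\<alpha>. T e \<alpha> - T d \<alpha>) \<le> C * q (\<lambda>\<alpha>. e \<alpha> - d \<alpha>)"
        unfolding sub[symmetric] by (intro le diff_mem eE d)
      also have "C * q (\<lambda>\<alpha>. e \<alpha> - d \<alpha>) \<le> C * \<delta>"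
        using qe C by (intro mult_left_mono) auto
      also have "C * \<delta> < (C + 1) * \<delta>" using \<delta> by simp
      also have "(C + 1) * \<delta> = \<epsilon> - p (\<lambda>\<alpha>. T d \<alpha> - c \<alpha>)" using C by (simp add: \<delta>_def)
      finally show ?thesis using eE mem by simp
    qed
    moreover have "d \<in> ?B" using d \<delta> seminorm_zero[OF q] by simp
    moreover have "openin ?X ?B" by (rule ball_open[OF q d \<delta>])
    ultimately show "\<exists>S. openin ?X S \<and> d \<in> S \<and> S \<subseteq> ?V" by (intro exI[of _ ?B]) blast
  qed
  then have "continuous_map ?X (topology_generated_by
     {{d \<in> E. p (\<lambda>\<alpha>. d \<alpha> - c \<alpha>) < \<epsilon>} | p c \<epsilon>. p \<in> P \<and> c \<in> E \<and> 0 < \<epsilon>}) T"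
  proof (intro continuous_on_generated_topo)
    show "T ` topspace ?X \<subseteq> \<Union> {{d \<in> E. p (\<lambda>\<alpha>. d \<alpha> - c \<alpha>) < \<epsilon>} | p c \<epsilon>. p \<in> P \<and> c \<in> E \<and> 0 < \<epsilon>}"
      using mem topspace_eq unfolding seminorm_topology_def topology_generated_by_topspace by auto
  qed (auto simp: topspace_eq)
  then show ?thesis by (simp add: seminorm_topology_def)
qed

lemma bounded_operator_ident: "bounded_operator E P (\<lambda>c. c)"
  unfolding bounded_operator_def by (metis mult_1 order_refl zero_le_one)

lemma bounded_operator_compose:
  assumes T: "bounded_operator E P T" and U: "bounded_operator E P U"
  shows "bounded_operator E P (\<lambda>c. T (U c))"
  unfolding bounded_operator_def
proof (intro conjI ballI)
  show "T (U c) \<in> E" if "c \<in> E" for c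
    using that T U by (simp add: bounded_operator_def)
  fix p assume "p \<in> P"
  then obtain q C where q: "q \<in> P" "0 \<le> C" "\<And>c. c \<in> E \<Longrightarrow> p (T c) \<le> C * q c"
    using T unfolding bounded_operator_def by blast
  then obtain r D where r: "r \<in> P" "0 \<le> D" "\<And>c. c \<in> E \<Longrightarrow> q (U c) \<le> D * r c"
    using U unfolding bounded_operator_def by blast
  have "p (T (U c)) \<le> (C * D) * r c" if "c \<in> E" for c
  proof -
    have "U c \<in> E" using U that by (simp add: bounded_operator_def)
    then have "p (T (U c)) \<le> C * q (U c)" by (rule q(3))
    also have "\<dots> \<le> C * (D * r c)" by (intro mult_left_mono r that q)
    finally show ?thesis by (simp add: mult.assoc)
  qed
  then show "\<exists>r\<in>P. \<exists>C\<ge>0. \<forall>c\<in>E. p (T (U c)) \<le> C * r c"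
    using r q by (intro bexI[of _ r] exI[of _ "C * D"]) auto
qed

text \<open>
  Directedness enters here: the two bounds of the summands have to be merged into one seminorm.
\<close>
lemma bounded_operator_add:
  assumes T: "bounded_operator E P T" and U: "bounded_operator E P U"
  shows "bounded_operator E P (\<lambda>c \<alpha>. T c \<alpha> + U c \<alpha>)"
  unfolding bounded_operator_def
proof (intro conjI ballI)
  show "(\<lambda>\<alpha>. T c \<alpha> + U c \<alpha>) \<in> E" if "c \<in> E" for c
    using that T U by (intro add_mem) (simp_all add: bounded_operator_def)
  fix p assume p: "p \<in> P"
  obtain q C where q: "q \<in> P" "0 \<le> C" "\<And>c. c \<in> E \<Longrightarrow> p (T c) \<le> C * q c"
    using T p unfolding bounded_operator_def by blast
  obtain r D where r: "r \<in> P" "0 \<le> D" "\<And>c. c \<in> E \<Longrightarrow> p (U c) \<le> D * r c"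
    using U p unfolding bounded_operator_def by blast
  obtain u where u: "u \<in> P" "\<And>c. c \<in> E \<Longrightarrow> q c \<le> u c \<and> r c \<le> u c"
    using directed[OF q(1) r(1)] by blast
  have "p (\<lambda>\<alpha>. T c \<alpha> + U c \<alpha>) \<le> (C + D) * u c" if c: "c \<in> E" for c
  proof -
    have "p (\<lambda>\<alpha>. T c \<alpha> + U c \<alpha>) \<le> p (T c) + p (U c)"
      using T U c by (intro seminorm_add p) (simp_all add: bounded_operator_def)
    also have "\<dots> \<le> C * q c + D * r c" using q r c by (intro add_mono) auto
    also have "\<dots> \<le> C * u c + D * u c" using u q r c by (intro add_mono mult_left_mono) auto
    finally show ?thesis by (simp add: distrib_right)
  qed
  then show "\<exists>u\<in>P. \<exists>C\<ge>0. \<forall>c\<in>E. p (\<lambda>\<alpha>. T c \<alpha> + U c \<alpha>) \<le> C * u c"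
    using u q r by (intro bexI[of _ u] exI[of _ "C + D"]) auto
qed

lemma bounded_operator_scale:
  assumes T: "bounded_operator E P T"
  shows "bounded_operator E P (\<lambda>c \<alpha>. k * T c \<alpha>)"
  unfolding bounded_operator_def
proof (intro conjI ballI)
  show "(\<lambda>\<alpha>. k * T c \<alpha>) \<in> E" if "c \<in> E" for c
    using that T by (intro scale_mem) (simp add: bounded_operator_def)
  fix p assume p: "p \<in> P"
  obtain q C where q: "q \<in> P" "0 \<le> C" "\<And>c. c \<in> E \<Longrightarrow> p (T c) \<le> C * q c"
    using T p unfolding bounded_operator_def by blast
  have "p (\<lambda>\<alpha>. k * T c \<alpha>) \<le> (cmod k * C) * q c" if c: "c \<in> E" for c
  proof -
    have "T c \<in> E" using T c by (simp add: bounded_operator_def)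
    then show ?thesis
      using mult_left_mono[OF q(3)[OF c], of "cmod k"] by (simp add: seminorm_scale[OF p] mult.assoc)
  qed
  then show "\<exists>u\<in>P. \<exists>C\<ge>0. \<forall>c\<in>E. p (\<lambda>\<alpha>. k * T c \<alpha>) \<le> C * u c"
    using q by (intro bexI[of _ q] exI[of _ "cmod k * C"]) auto
qed

lemma continuous_ladder_algebra:
  assumes "\<And>j. bounded_operator E P (up j)" "\<And>j. bounded_operator E P (down j)"
    and T: "T \<in> ladder_algebra"
  shows "continuous_map (seminorm_topology E P) (seminorm_topology E P) T"
proof (rule bounded_operator_continuous[OF linear_ladder_algebra[OF T]])
  show "bounded_operator E P T"
    using T
  proof (induction rule: ladder_algebra.induct)
    case ident
    show ?case by (rule bounded_operator_ident)
  next
    case (up T j)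
    then show ?case using bounded_operator_compose[OF assms(1)] by blast
  next
    case (down T j)
    then show ?case using bounded_operator_compose[OF assms(2)] by blast
  next
    case (add T U)
    then show ?case using bounded_operator_add by blast
  next
    case (scale T k)
    then show ?case using bounded_operator_scale by blast
  qed
qed

end

section \<open>Projective and inductive limits of chains of seminormed spaces\<close>

lemma seminorm_on_compose:
  assumes "seminorm_on E p" "linear_operator T" "\<And>c. c \<in> E \<Longrightarrow> T c \<in> E"
  shows "seminorm_on E (\<lambda>c. p (T c))"
  using assms unfolding seminorm_on_def linear_operator_def by simp

text \<open>
  The steps of all limits considered here are linearly ordered by continuous inclusion. The order of
  the index set itself is left open: the weighted spaces shrink with the parameter \<open>r\<close>, whereas their
  duals and the spaces of finite series grow.
\<close>
locale seminormed_chain =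
  fixes I :: "'i set" and E :: "'i \<Rightarrow> 'n::finite formal_series set"
    and N :: "'i \<Rightarrow> 'n formal_series \<Rightarrow> real"
  assumes nonempty: "I \<noteq> {}"
    and subspace: "i \<in> I \<Longrightarrow> subspace_of_series (E i)"
    and seminorm: "i \<in> I \<Longrightarrow> seminorm_on (E i) (N i)"
    and chain: "i \<in> I \<Longrightarrow> k \<in> I \<Longrightarrow>
      (E i \<subseteq> E k \<and> (\<forall>c\<in>E i. N k c \<le> N i c)) \<or> (E k \<subseteq> E i \<and> (\<forall>c\<in>E k. N i c \<le> N k c))"
begin

definition maps :: "('n formal_series \<Rightarrow> 'n formal_series) \<Rightarrow> 'i \<Rightarrow> 'i \<Rightarrow> bool" where
  "maps T k i \<longleftrightarrow> (\<exists>C\<ge>0. \<forall>c\<in>E k. T c \<in> E i \<and> N i (T c) \<le> C * N k c)"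

abbreviation continuous_seminorms :: "('n formal_series \<Rightarrow> real) set" where
  "continuous_seminorms \<equiv>
     {p. seminorm_on (\<Union>i\<in>I. E i) p \<and> (\<forall>i\<in>I. \<exists>C. \<forall>c\<in>E i. p c \<le> C * N i c)}"

lemma directed_projective: "directed_seminorms (\<Inter>i\<in>I. E i) (N ` I)"
proof
  show "subspace_of_series (\<Inter>i\<in>I. E i)"
    using subspace unfolding subspace_of_series_def by simp
  show "N ` I \<noteq> {}" using nonempty by simp
  show "seminorm_on (\<Inter>i\<in>I. E i) p" if "p \<in> N ` I" for p
    using that seminorm unfolding seminorm_on_def by (elim imageE) simp
  show "\<exists>r\<in>N ` I. \<forall>c\<in>\<Inter>i\<in>I. E i. p c \<le> r c \<and> q c \<le> r c"
    if p: "p \<in> N ` I" and q: "q \<in> N ` I" for p q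
  proof -
    obtain i k where ik: "i \<in> I" "k \<in> I" and [simp]: "p = N i" "q = N k" using p q by (elim imageE)
    show ?thesis
      using chain[OF ik]
    proof
      assume "E i \<subseteq> E k \<and> (\<forall>c\<in>E i. N k c \<le> N i c)"
      with ik show ?thesis by (intro bexI[of _ "N i"]) auto
    next
      assume "E k \<subseteq> E i \<and> (\<forall>c\<in>E k. N i c \<le> N k c)"
      with ik show ?thesis by (intro bexI[of _ "N k"]) auto
    qed
  qed
qed

text \<open>
  The seminorms that are continuous on every step are closed under sums, hence directed. The union of
  the steps is a vector space because any two steps are comparable.
\<close>
lemma directed_inductive: "directed_seminorms (\<Union>i\<in>I. E i) continuous_seminorms"
proof
  let ?E = "\<Union>i\<in>I. E i"
  have "(\<lambda>\<alpha>. c \<alpha> + d \<alpha>) \<in> ?E" if c: "c \<in> ?E" and d: "d \<in> ?E" for c d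
  proof -
    obtain i k where ik: "i \<in> I" "k \<in> I" and "c \<in> E i" "d \<in> E k" using c d by blast
    then have "c \<in> E i \<and> d \<in> E i \<or> c \<in> E k \<and> d \<in> E k"
      using chain[OF ik] by blast
    then have "(\<lambda>\<alpha>. c \<alpha> + d \<alpha>) \<in> E i \<or> (\<lambda>\<alpha>. c \<alpha> + d \<alpha>) \<in> E k"
      using subspace[OF ik(1)] subspace[OF ik(2)] unfolding subspace_of_series_def by metis
    then show ?thesis using ik by blast
  qed
  moreover have "(\<lambda>\<alpha>. 0) \<in> ?E"
    using nonempty subspace unfolding subspace_of_series_def by auto
  moreover have "(\<lambda>\<alpha>. k * c \<alpha>) \<in> ?E" if c: "c \<in> ?E" for c k
  proof -
    obtain i where i: "i \<in> I" "c \<in> E i" using c by blast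
    then have "(\<lambda>\<alpha>. k * c \<alpha>) \<in> E i" using subspace unfolding subspace_of_series_def by simp
    then show ?thesis using i by blast
  qed
  ultimately show "subspace_of_series ?E"
    unfolding subspace_of_series_def by simp
  have "(\<lambda>c. 0) \<in> continuous_seminorms"
    by (auto simp: seminorm_on_def intro!: exI[of _ 0])
  then show "continuous_seminorms \<noteq> {}" by blast
  show "seminorm_on ?E p" if "p \<in> continuous_seminorms" for p
    using that by simp
  show "\<exists>r\<in>continuous_seminorms. \<forall>c\<in>?E. p c \<le> r c \<and> q c \<le> r c"
    if p: "p \<in> continuous_seminorms" and q: "q \<in> continuous_seminorms" for p q
  proof (intro bexI[of _ "\<lambda>c. p c + q c"])
    show "\<forall>c\<in>?E. p c \<le> p c + q c \<and> q c \<le> p c + q c"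
      using p q unfolding seminorm_on_def by auto
    have "seminorm_on ?E (\<lambda>c. p c + q c)"
      unfolding seminorm_on_def
    proof (intro conjI ballI allI)
      fix c d k assume c: "c \<in> ?E"
      show "0 \<le> p c + q c" using p q c unfolding seminorm_on_def by auto
      show "p (\<lambda>\<alpha>. k * c \<alpha>) + q (\<lambda>\<alpha>. k * c \<alpha>) = cmod k * (p c + q c)"
        using p q c unfolding seminorm_on_def by (auto simp: distrib_left)
      assume d: "d \<in> ?E"
      have "p (\<lambda>\<alpha>. c \<alpha> + d \<alpha>) \<le> p c + p d" "q (\<lambda>\<alpha>. c \<alpha> + d \<alpha>) \<le> q c + q d"
        using p q c d unfolding seminorm_on_def by blast+
      then show "p (\<lambda>\<alpha>. c \<alpha> + d \<alpha>) + q (\<lambda>\<alpha>. c \<alpha> + d \<alpha>) \<le> p c + q c + (p d + q d)" by linarith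
    qed
    moreover have "\<exists>C. \<forall>c\<in>E i. p c + q c \<le> C * N i c" if i: "i \<in> I" for i
    proof -
      obtain C D where "\<forall>c\<in>E i. p c \<le> C * N i c" "\<forall>c\<in>E i. q c \<le> D * N i c"
        using p q i by blast
      then have "\<forall>c\<in>E i. p c + q c \<le> (C + D) * N i c"
        by (auto simp: distrib_right intro: add_mono)
      then show ?thesis by blast
    qed
    ultimately show "(\<lambda>c. p c + q c) \<in> continuous_seminorms" by blast
  qed
qed

text \<open>
  For a projective limit every target step \<open>i\<close> must be reached from some source step \<open>k\<close>; for an
  inductive limit, conversely, every source step must be mapped into some target step.
\<close>
lemma bounded_operator_projective:
  assumes "\<And>i. i \<in> I \<Longrightarrow> \<exists>k\<in>I. maps T k i"
  shows "bounded_operator (\<Inter>i\<in>I. E i) (N ` I) T"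
  unfolding bounded_operator_def
proof (intro conjI ballI)
  show "T c \<in> (\<Inter>i\<in>I. E i)" if "c \<in> (\<Inter>i\<in>I. E i)" for c
    using assms that unfolding maps_def by blast
  show "\<exists>q\<in>N ` I. \<exists>C\<ge>0. \<forall>c\<in>\<Inter>i\<in>I. E i. p (T c) \<le> C * q c" if p: "p \<in> N ` I" for p
  proof -
    obtain i where i: "i \<in> I" and p: "p = N i" using p by (elim imageE)
    obtain k C where "k \<in> I" "0 \<le> C" "\<forall>c\<in>E k. T c \<in> E i \<and> N i (T c) \<le> C * N k c"
      using assms[OF i] unfolding maps_def by blast
    then show ?thesis unfolding p by (intro bexI[of _ "N k"] exI[of _ C]) auto
  qed
qed

lemma bounded_operator_inductive:
  assumes lin: "linear_operator T" and "\<And>k. k \<in> I \<Longrightarrow> \<exists>i\<in>I. maps T k i"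
  shows "bounded_operator (\<Union>i\<in>I. E i) continuous_seminorms T"
proof -
  let ?E = "\<Union>i\<in>I. E i"
  have mem: "T c \<in> ?E" if "c \<in> ?E" for c
    using assms(2) that unfolding maps_def by blast
  \<comment> \<open>the seminorm \<open>p \<circ> T\<close> is itself continuous on every step and bounds \<open>p \<circ> T\<close> trivially\<close>
  have "(\<lambda>c. p (T c)) \<in> continuous_seminorms" if p: "p \<in> continuous_seminorms" for p
  proof -
    have "seminorm_on ?E (\<lambda>c. p (T c))"
      using p mem by (intro seminorm_on_compose[OF _ lin]) blast+
    moreover have "\<exists>C. \<forall>c\<in>E k. p (T c) \<le> C * N k c" if k: "k \<in> I" for k
    proof -
      obtain i C where i: "i \<in> I" "0 \<le> C" "\<forall>c\<in>E k. T c \<in> E i \<and> N i (T c) \<le> C * N k c"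
        using assms(2)[OF k] unfolding maps_def by blast
      obtain D where D: "\<forall>c\<in>E i. p c \<le> D * N i c" using p i by blast
      have "p (T c) \<le> (\<bar>D\<bar> * C) * N k c" if c: "c \<in> E k" for c
      proof -
        have Tc: "T c \<in> E i" using i c by blast
        then have "0 \<le> N i (T c)" using seminorm[OF i(1)] unfolding seminorm_on_def by blast
        then have "p (T c) \<le> \<bar>D\<bar> * N i (T c)"
          using D Tc by (meson abs_ge_self mult_right_mono order_trans)
        also have "\<dots> \<le> \<bar>D\<bar> * (C * N k c)" using i c by (intro mult_left_mono) auto
        finally show ?thesis by (simp add: mult.assoc)
      qed
      then show ?thesis by blast
    qed
    ultimately show ?thesis by blast
  qed
  then show ?thesis
    unfolding bounded_operator_def using mem by (metis (no_types, lifting) mult_1 order_refl zero_le_one)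
qed

lemma continuous_projective:
  assumes "\<And>i j. i \<in> I \<Longrightarrow> \<exists>k\<in>I. maps (up j) k i" "\<And>i j. i \<in> I \<Longrightarrow> \<exists>k\<in>I. maps (down j) k i"
    and "T \<in> ladder_algebra"
  shows "continuous_map (projective_limit I E N) (projective_limit I E N) T"
  unfolding projective_limit_def
  using assms
  by (intro directed_seminorms.continuous_ladder_algebra[OF directed_projective] bounded_operator_projective)

lemma continuous_inductive:
  assumes "\<And>k j. k \<in> I \<Longrightarrow> \<exists>i\<in>I. maps (up j) k i" "\<And>k j. k \<in> I \<Longrightarrow> \<exists>i\<in>I. maps (down j) k i"
    and "T \<in> ladder_algebra"
  shows "continuous_map (inductive_limit I E N) (inductive_limit I E N) T"
  unfolding inductive_limit_def
  using assms
  by (intro directed_seminorms.continuous_ladder_algebra[OF directed_inductive]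
      bounded_operator_inductive linear_up linear_down)

end

section \<open>Weighted spaces\<close>

lemma weighted_norm_le:
  assumes "\<And>\<alpha>. cmod (c \<alpha>) * w \<alpha> \<le> B"
  shows "c \<in> weighted_space w" "weighted_norm w c \<le> B"
  using assms by (auto simp: weighted_space_def weighted_norm_def intro!: cSUP_least bdd_aboveI)

lemma le_weighted_norm:
  "c \<in> weighted_space w \<Longrightarrow> cmod (c \<alpha>) * w \<alpha> \<le> weighted_norm w c"
  unfolding weighted_space_def weighted_norm_def by (auto intro: cSUP_upper)

lemma weighted_norm_scale_le:
  assumes "c \<in> weighted_space w"
  shows "(\<lambda>\<alpha>. k * c \<alpha>) \<in> weighted_space w" "weighted_norm w (\<lambda>\<alpha>. k * c \<alpha>) \<le> cmod k * weighted_norm w c"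
  using mult_left_mono[OF le_weighted_norm[OF assms], of "cmod k"]
  by (auto intro!: weighted_norm_le simp: norm_mult mult.assoc)

lemma seminorm_weighted_norm:
  assumes w: "\<And>\<alpha>. 0 \<le> w \<alpha>"
  shows "subspace_of_series (weighted_space w)" "seminorm_on (weighted_space w) (weighted_norm w)"
proof -
  let ?E = "weighted_space w" and ?N = "weighted_norm w"
  have add: "(\<lambda>\<alpha>. c \<alpha> + d \<alpha>) \<in> ?E" "?N (\<lambda>\<alpha>. c \<alpha> + d \<alpha>) \<le> ?N c + ?N d" if "c \<in> ?E" "d \<in> ?E" for c d
  proof -
    have "cmod (c \<alpha> + d \<alpha>) * w \<alpha> \<le> ?N c + ?N d" for \<alpha>
      using mult_right_mono[OF norm_triangle_ineq w, of "c \<alpha>" "d \<alpha>" \<alpha>]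
        le_weighted_norm[OF that(1), of \<alpha>] le_weighted_norm[OF that(2), of \<alpha>]
      by (simp add: distrib_right)
    then show "(\<lambda>\<alpha>. c \<alpha> + d \<alpha>) \<in> ?E" "?N (\<lambda>\<alpha>. c \<alpha> + d \<alpha>) \<le> ?N c + ?N d"
      by (rule weighted_norm_le)+
  qed
  have nonneg: "0 \<le> ?N c" if "c \<in> ?E" for c
    using le_weighted_norm[OF that] w by (meson mult_nonneg_nonneg norm_ge_zero order_trans)
  have zero: "(\<lambda>\<alpha>. 0) \<in> ?E"
    by (rule weighted_norm_le[of _ _ 0]) simp
  show "subspace_of_series ?E"
    unfolding subspace_of_series_def using zero add(1) weighted_norm_scale_le(1) by blast
  have scale: "?N (\<lambda>\<alpha>. k * c \<alpha>) = cmod k * ?N c" if c: "c \<in> ?E" for k c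
  proof (cases "k = 0")
    case True
    then show ?thesis by (simp add: weighted_norm_def)
  next
    case False
    have "?N c \<le> cmod (inverse k) * ?N (\<lambda>\<alpha>. k * c \<alpha>)"
      using weighted_norm_scale_le(2)[OF weighted_norm_scale_le(1)[OF c, of k], of "inverse k"] False
      by (simp add: mult.assoc[symmetric])
    then have "cmod k * ?N c \<le> ?N (\<lambda>\<alpha>. k * c \<alpha>)"
      using False by (simp add: norm_divide norm_inverse field_simps)
    with weighted_norm_scale_le(2)[OF c, of k] show ?thesis by (rule antisym)
  qed
  show "seminorm_on ?E ?N"
    unfolding seminorm_on_def using nonneg add(2) scale by blast
qed

lemma weighted_space_mono:
  assumes "\<And>\<alpha>. w \<alpha> \<le> w' \<alpha>" "c \<in> weighted_space w'"
  shows "c \<in> weighted_space w" "weighted_norm w c \<le> weighted_norm w' c"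
proof -
  have "cmod (c \<alpha>) * w \<alpha> \<le> weighted_norm w' c" for \<alpha>
    using mult_left_mono[OF assms(1) norm_ge_zero] le_weighted_norm[OF assms(2)] order_trans by blast
  then show "c \<in> weighted_space w" "weighted_norm w c \<le> weighted_norm w' c"
    by (rule weighted_norm_le)+
qed

text \<open>
  The conditions on two weights under which \<^term>\<open>up j\<close> and \<^term>\<open>down j\<close> map the space with weight
  \<open>w\<close> boundedly into the space with weight \<open>w'\<close>, both expressed at the smaller of the two multi-indices
  involved.
\<close>
definition ladder_dominated :: "('n::finite multi_index \<Rightarrow> real) \<Rightarrow> ('n multi_index \<Rightarrow> real) \<Rightarrow> bool" where
  "ladder_dominated w' w \<longleftrightarrow> (\<exists>K\<ge>0. \<forall>j \<beta>.
     sqrt (real (Suc (\<beta> $ j)) / 2) * w' (\<beta> + axis j 1) \<le> K * w \<beta> \<and>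
     sqrt (real (Suc (\<beta> $ j)) / 2) * w' \<beta> \<le> K * w (\<beta> + axis j 1))"

lemma ladder_dominated_up_down:
  assumes w: "\<And>\<alpha>. 0 \<le> w \<alpha>" and dom: "ladder_dominated w' w"
  shows "\<exists>K\<ge>0. \<forall>c\<in>weighted_space w. up j c \<in> weighted_space w' \<and>
      weighted_norm w' (up j c) \<le> K * weighted_norm w c"
    and "\<exists>K\<ge>0. \<forall>c\<in>weighted_space w. down j c \<in> weighted_space w' \<and>
      weighted_norm w' (down j c) \<le> K * weighted_norm w c"
proof -
  obtain K where K: "0 \<le> K"
    and Ku: "\<And>\<beta>. sqrt (real (Suc (\<beta> $ j)) / 2) * w' (\<beta> + axis j 1) \<le> K * w \<beta>"
    and Kd: "\<And>\<beta>. sqrt (real (Suc (\<beta> $ j)) / 2) * w' \<beta> \<le> K * w (\<beta> + axis j 1)"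
    using dom unfolding ladder_dominated_def by blast
  have key: "cmod a * t \<le> K * B" if "t \<le> K * v" "cmod a * v \<le> B" for a t v B
  proof -
    have "cmod a * t \<le> cmod a * (K * v)" by (intro mult_left_mono that) simp
    also have "\<dots> = K * (cmod a * v)" by simp
    also have "\<dots> \<le> K * B" by (intro mult_left_mono that K)
    finally show ?thesis .
  qed
  have up: "cmod (up j c \<alpha>) * w' \<alpha> \<le> K * weighted_norm w c" if c: "c \<in> weighted_space w" for c \<alpha>
  proof (cases "\<alpha> $ j = 0")
    case True
    have "0 \<le> weighted_norm w c"
      using seminorm_weighted_norm(2)[of w] w c unfolding seminorm_on_def by blast
    with True K show ?thesis by (simp add: up_def)
  next
    case False
    define \<beta> where "\<beta> = \<alpha> - axis j 1"
    have \<alpha>: "\<alpha> = \<beta> + axis j 1" using False by (auto simp: \<beta>_def vec_eq_iff axis_def)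
    have j: "\<alpha> $ j = Suc (\<beta> $ j)" by (simp add: \<alpha> axis_def)
    have "cmod (c \<beta>) * (sqrt (real (Suc (\<beta> $ j)) / 2) * w' (\<beta> + axis j 1)) \<le> K * weighted_norm w c"
      by (rule key[OF Ku le_weighted_norm[OF c]])
    then show ?thesis
      unfolding up_def \<beta>_def[symmetric] j by (simp add: norm_mult \<alpha> mult_ac)
  qed
  have down: "cmod (down j c \<alpha>) * w' \<alpha> \<le> K * weighted_norm w c" if c: "c \<in> weighted_space w" for c \<alpha>
    using key[OF Kd le_weighted_norm[OF c], of \<alpha>]
    by (simp add: down_def norm_mult mult_ac)
  show "\<exists>K\<ge>0. \<forall>c\<in>weighted_space w. up j c \<in> weighted_space w' \<and>
      weighted_norm w' (up j c) \<le> K * weighted_norm w c"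
    by (intro exI[of _ K] conjI ballI K weighted_norm_le[OF up])
  show "\<exists>K\<ge>0. \<forall>c\<in>weighted_space w. down j c \<in> weighted_space w' \<and>
      weighted_norm w' (down j c) \<le> K * weighted_norm w c"
    by (intro exI[of _ K] conjI ballI K weighted_norm_le[OF down])
qed

text \<open>
  The operators \<^term>\<open>up j\<close> and \<^term>\<open>down j\<close> are transposes of each other, and taking reciprocals exchanges the two conditions. So the duals require no separate estimates.
\<close>
lemma ladder_dominated_inverse:
  assumes "\<And>\<alpha>. 0 < w \<alpha>" "\<And>\<alpha>. 0 < w' \<alpha>" "ladder_dominated w' w"
  shows "ladder_dominated (\<lambda>\<alpha>. 1 / w \<alpha>) (\<lambda>\<alpha>. 1 / w' \<alpha>)"
proof -
  have flip: "t * (1 / a) \<le> K * (1 / b)" if "t * b \<le> K * a" "0 < a" "0 < b" for t a b K :: real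
    using that by (simp add: field_simps)
  show ?thesis
    using assms(3) unfolding ladder_dominated_def
    by (elim exE conjE) (meson assms(1,2) flip)
qed

text \<open>
  Ladder operators lose an arbitrarily small part of the parameter \<open>r\<close>. This loss is absorbed by the
  limits: each step has other steps above and below it.
\<close>
lemma continuous_weighted:
  fixes w :: "real \<Rightarrow> 'n::finite multi_index \<Rightarrow> real"
  assumes pos: "\<And>r \<alpha>. 0 < r \<Longrightarrow> 0 < w r \<alpha>"
    and mono: "\<And>r r' \<alpha>. 0 < r' \<Longrightarrow> r' \<le> r \<Longrightarrow> w r' \<alpha> \<le> w r \<alpha>"
    and dom: "\<And>r r'. 0 < r' \<Longrightarrow> r' < r \<Longrightarrow> ladder_dominated (w r') (w r)"
    and T: "T \<in> ladder_algebra"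
  defines "E \<equiv> \<lambda>r. weighted_space (w r)" and "N \<equiv> \<lambda>r. weighted_norm (w r)"
    and "E' \<equiv> \<lambda>r. weighted_space (\<lambda>\<alpha>. 1 / w r \<alpha>)" and "N' \<equiv> \<lambda>r. weighted_norm (\<lambda>\<alpha>. 1 / w r \<alpha>)"
  shows "continuous_map (projective_limit {0<..} E N) (projective_limit {0<..} E N) T"
    and "continuous_map (inductive_limit {0<..} E N) (inductive_limit {0<..} E N) T"
    and "continuous_map (projective_limit {0<..} E' N') (projective_limit {0<..} E' N') T"
    and "continuous_map (inductive_limit {0<..} E' N') (inductive_limit {0<..} E' N') T"
proof -
  have pos': "0 < 1 / w r \<alpha>" if "0 < r" for r \<alpha> using pos[OF that] by simp
  have mono': "1 / w r \<alpha> \<le> 1 / w r' \<alpha>" if "0 < r'" "r' \<le> r" for r r' \<alpha>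
    using mono[OF that] pos[of r'] pos[of r] that by (simp add: frac_le)
  interpret C: seminormed_chain "{0<..}" E N
  proof
    fix i k :: real assume ik: "i \<in> {0<..}" "k \<in> {0<..}"
    show "subspace_of_series (E i)" "seminorm_on (E i) (N i)"
      unfolding E_def N_def using ik pos by (auto intro!: seminorm_weighted_norm less_imp_le)
    have "E k \<subseteq> E i \<and> (\<forall>c\<in>E k. N i c \<le> N k c)" if "0 < i" "i \<le> k" for i k
      unfolding E_def N_def using weighted_space_mono[of "w i" "w k", OF mono[OF that]] by blast
    then show "(E i \<subseteq> E k \<and> (\<forall>c\<in>E i. N k c \<le> N i c)) \<or> (E k \<subseteq> E i \<and> (\<forall>c\<in>E k. N i c \<le> N k c))"
      using ik linear[of i k] by auto
  qed auto
  interpret C': seminormed_chain "{0<..}" E' N'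
  proof
    fix i k :: real assume ik: "i \<in> {0<..}" "k \<in> {0<..}"
    show "subspace_of_series (E' i)" "seminorm_on (E' i) (N' i)"
      unfolding E'_def N'_def using ik pos' by (auto intro!: seminorm_weighted_norm less_imp_le)
    have "E' i \<subseteq> E' k \<and> (\<forall>c\<in>E' i. N' k c \<le> N' i c)" if "0 < i" "i \<le> k" for i k
      unfolding E'_def N'_def
      using weighted_space_mono[of "\<lambda>\<alpha>. 1 / w k \<alpha>" "\<lambda>\<alpha>. 1 / w i \<alpha>", OF mono'[OF that]] by blast
    then show "(E' i \<subseteq> E' k \<and> (\<forall>c\<in>E' i. N' k c \<le> N' i c)) \<or> (E' k \<subseteq> E' i \<and> (\<forall>c\<in>E' k. N' i c \<le> N' k c))"
      using ik linear[of i k] by auto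
  qed auto
  have m: "C.maps (up j) r r'" "C.maps (down j) r r'" if "0 < r'" "r' < r" for r r' j
    unfolding C.maps_def unfolding E_def N_def
    using ladder_dominated_up_down[OF less_imp_le[OF pos] dom[OF that], where j = j] that by auto
  have m': "C'.maps (up j) r' r" "C'.maps (down j) r' r" if "0 < r'" "r' < r" for r r' j
  proof -
    have "ladder_dominated (\<lambda>\<alpha>. 1 / w r \<alpha>) (\<lambda>\<alpha>. 1 / w r' \<alpha>)"
      using that by (intro ladder_dominated_inverse dom pos) auto
    from ladder_dominated_up_down[OF less_imp_le[OF pos'[OF that(1)]] this, where j = j]
    show "C'.maps (up j) r' r" "C'.maps (down j) r' r"
      unfolding C'.maps_def unfolding E'_def N'_def by auto
  qed
  show "continuous_map (projective_limit {0<..} E N) (projective_limit {0<..} E N) T"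
  proof (rule C.continuous_projective[OF _ _ T])
    fix r :: real and j assume "r \<in> {0<..}"
    then have "0 < r" "r < r + 1" "r + 1 \<in> {0<..}" by auto
    then show "\<exists>k\<in>{0<..}. C.maps (up j) k r" "\<exists>k\<in>{0<..}. C.maps (down j) k r"
      using m by blast+
  qed
  show "continuous_map (inductive_limit {0<..} E N) (inductive_limit {0<..} E N) T"
  proof (rule C.continuous_inductive[OF _ _ T])
    fix r :: real and j assume "r \<in> {0<..}"
    then have "0 < r / 2" "r / 2 < r" "r / 2 \<in> {0<..}" by auto
    then show "\<exists>i\<in>{0<..}. C.maps (up j) r i" "\<exists>i\<in>{0<..}. C.maps (down j) r i"
      using m by blast+
  qed
  show "continuous_map (projective_limit {0<..} E' N') (projective_limit {0<..} E' N') T"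
  proof (rule C'.continuous_projective[OF _ _ T])
    fix r :: real and j assume "r \<in> {0<..}"
    then have "0 < r / 2" "r / 2 < r" "r / 2 \<in> {0<..}" by auto
    then show "\<exists>k\<in>{0<..}. C'.maps (up j) k r" "\<exists>k\<in>{0<..}. C'.maps (down j) k r"
      using m' by blast+
  qed
  show "continuous_map (inductive_limit {0<..} E' N') (inductive_limit {0<..} E' N') T"
  proof (rule C'.continuous_inductive[OF _ _ T])
    fix r :: real and j assume "r \<in> {0<..}"
    then have "0 < r" "r < r + 1" "r + 1 \<in> {0<..}" by auto
    then show "\<exists>i\<in>{0<..}. C'.maps (up j) r i" "\<exists>i\<in>{0<..}. C'.maps (down j) r i"
      using m' by blast+
  qed
qed

section \<open>Growth of the weights\<close>

lemma LIMSEQ_bounded_above: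
  fixes X :: "nat \<Rightarrow> real"
  assumes "X \<longlonglongrightarrow> L"
  obtains K where "\<And>n. X n \<le> K"
proof -
  obtain K where "\<forall>n. norm (X n) \<le> K"
    using convergent_imp_Bseq[OF convergentI[OF assms]] unfolding Bseq_def by blast
  then have "X n \<le> K" for n by (simp add: abs_le_iff)
  then show ?thesis by (rule that)
qed

lemma mi_component_le_size: "\<alpha> $ j \<le> mi_size \<alpha>"
  unfolding mi_size_def by (rule member_le_sum) auto

lemma sqrt_component_le: "sqrt (real (Suc (\<beta> $ j)) / 2) \<le> sqrt (real (Suc (mi_size \<beta>)))"
  using mi_component_le_size[of \<beta> j] by simp

text \<open>
  With \<open>p = 1 / (2 s)\<close> and \<open>n = |\<beta>|\<close>, the exponent \<open>r' (n + 1)\<^sup>p - r n\<^sup>p\<close> behaves like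
  \<open>- (r - r') n\<^sup>p\<close>, also for \<open>p > 1\<close>, where \<open>(n + 1)\<^sup>p - n\<^sup>p\<close> is unbounded but of lower order. It
  therefore beats the factor \<open>\<surd>(n + 1)\<close>.
\<close>
lemma ladder_dominated_exp_weight:
  assumes "0 < s" "0 < r'" "r' < r"
  shows "ladder_dominated (weight r' (Real_index s)) (weight r (Real_index s))"
proof -
  define p where "p = 1 / (2 * s)"
  have p: "0 < p" using assms by (simp add: p_def)
  have "(\<lambda>n. sqrt (real (Suc n)) * exp (r' * real (Suc n) powr p - r * real n powr p)) \<longlonglongrightarrow> 0"
    using assms(2,3) p by real_asymp
  then obtain K where K: "\<And>n. sqrt (real (Suc n)) * exp (r' * real (Suc n) powr p - r * real n powr p) \<le> K"
    using LIMSEQ_bounded_above by blast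
  show ?thesis
    unfolding ladder_dominated_def
  proof (intro exI[of _ K] conjI allI)
    show "0 \<le> K" by (rule order_trans[OF _ K[of 0]]) simp
    fix j and \<beta> :: "nat ^ 'a"
    define n where "n = mi_size \<beta>"
    have step: "sqrt (real (Suc (\<beta> $ j)) / 2) * exp a \<le> K * exp b"
      if "a - b \<le> r' * real (Suc n) powr p - r * real n powr p" for a b
    proof -
      have "sqrt (real (Suc (\<beta> $ j)) / 2) * exp (a - b) \<le>
          sqrt (real (Suc n)) * exp (r' * real (Suc n) powr p - r * real n powr p)"
        using that sqrt_component_le[of \<beta> j] unfolding n_def by (intro mult_mono) auto
      also have "\<dots> \<le> K" by (rule K)
      finally have "sqrt (real (Suc (\<beta> $ j)) / 2) * exp (a - b) * exp b \<le> K * exp b"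
        by (rule mult_right_mono) simp
      then show ?thesis by (simp add: mult.assoc flip: exp_add)
    qed
    have w: "weight t (Real_index s) \<beta> = exp (t * real n powr p)"
      "weight t (Real_index s) (\<beta> + axis j 1) = exp (t * real (Suc n) powr p)" for t
      by (simp_all only: weight.simps mi_size_add_axis n_def p_def)
    show "sqrt (real (Suc (\<beta> $ j)) / 2) * weight r' (Real_index s) (\<beta> + axis j 1)
        \<le> K * weight r (Real_index s) \<beta>"
      unfolding w by (rule step) simp
    have le: "real n powr p \<le> real (Suc n) powr p"
      using p by (intro powr_mono2) auto
    have "0 \<le> (r' + r) * (real (Suc n) powr p - real n powr p)"
      using assms le by (intro mult_nonneg_nonneg) auto
    then show "sqrt (real (Suc (\<beta> $ j)) / 2) * weight r' (Real_index s) \<beta>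
        \<le> K * weight r (Real_index s) (\<beta> + axis j 1)"
      unfolding w by (intro step) (simp add: algebra_simps)
  qed
qed

text \<open>
  The step from \<open>\<beta>\<close> to \<open>\<beta> + e\<^sub>j\<close> multiplies the factorial part of the weight by the power
  \<open>(\<beta>\<^sub>j + 1)\<^sup>q\<close>, \<open>q = 1 / (2 \<sigma>)\<close>, which together with the factor from the ladder operator is absorbed
  by the geometric decay of \<open>(r' / r)\<^bsup>|\<beta>|\<^esup>\<close>.
\<close>
lemma ladder_dominated_flat_weight:
  assumes "0 < \<sigma>" "0 < r'" "r' < r"
  shows "ladder_dominated (weight r' (Flat \<sigma>)) (weight r (Flat \<sigma>))"
proof -
  define q where "q = 1 / (2 * \<sigma>)"
  have q: "0 < q" using assms by (simp add: q_def)
  define \<rho> where "\<rho> = r' / r"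
  have \<rho>: "0 < \<rho>" "\<rho> < 1" using assms by (simp_all add: \<rho>_def)
  have "(\<lambda>n. sqrt (real (Suc n)) * real (Suc n) powr q * \<rho> ^ n) \<longlonglongrightarrow> 0"
    using \<rho> q by real_asymp
  then obtain K where K: "\<And>n. sqrt (real (Suc n)) * real (Suc n) powr q * \<rho> ^ n \<le> K"
    using LIMSEQ_bounded_above by blast
  have K0: "0 \<le> K" by (rule order_trans[OF _ K[of 0]]) simp
  have bound: "sqrt (real (Suc m) / 2) * real (Suc m) powr q * r' ^ n \<le> K * r ^ n" if "m \<le> n" for m n
  proof -
    have "sqrt (real (Suc m) / 2) * real (Suc m) powr q * \<rho> ^ n \<le>
        sqrt (real (Suc n)) * real (Suc n) powr q * \<rho> ^ n"
      using that \<rho> q by (intro mult_right_mono mult_mono powr_mono2) auto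
    also have "\<dots> \<le> K" by (rule K)
    finally have "sqrt (real (Suc m) / 2) * real (Suc m) powr q * \<rho> ^ n * r ^ n \<le> K * r ^ n"
      using assms by (intro mult_right_mono) auto
    moreover have "\<rho> ^ n * r ^ n = r' ^ n"
      using assms by (simp add: \<rho>_def flip: power_mult_distrib)
    ultimately show ?thesis by (simp add: mult.assoc)
  qed
  show ?thesis
    unfolding ladder_dominated_def
  \<comment> \<open>raising costs a factor \<open>r'\<close> from the power in the weight, lowering gains a factor \<open>r\<close>; the constant covers both\<close>
  proof (intro exI[of _ "K * (r' + 1 / r)"] conjI allI)
    show "0 \<le> K * (r' + 1 / r)" using K0 assms by simp
    fix j and \<beta> :: "nat ^ 'a"
    define n m F where "n = mi_size \<beta>" and "m = \<beta> $ j" and "F = mi_fact \<beta> powr q"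
    have mn: "m \<le> n" unfolding m_def n_def by (rule mi_component_le_size)
    have F: "0 \<le> F" by (simp add: F_def)
    have w: "weight t (Flat \<sigma>) \<beta> = t ^ n * F"
      "weight t (Flat \<sigma>) (\<beta> + axis j 1) = t * t ^ n * (real (Suc m) powr q * F)" for t
      unfolding weight.simps mi_size_add_axis mi_fact_add_axis n_def m_def F_def q_def
      by (simp_all add: powr_mult mi_fact_def prod_nonneg)
    note b = bound[OF mn]
    have "sqrt (real (Suc m) / 2) * weight r' (Flat \<sigma>) (\<beta> + axis j 1) =
        (sqrt (real (Suc m) / 2) * real (Suc m) powr q * r' ^ n) * (r' * F)"
      unfolding w by (simp only: mult_ac)
    also have "\<dots> \<le> (K * r ^ n) * (r' * F)"
      using b assms F by (intro mult_right_mono) auto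
    also have "\<dots> = (K * r') * (r ^ n * F)" by (simp only: mult_ac)
    also have "\<dots> \<le> (K * (r' + 1 / r)) * (r ^ n * F)"
      using K0 assms F by (intro mult_right_mono mult_left_mono) auto
    finally show "sqrt (real (Suc (\<beta> $ j)) / 2) * weight r' (Flat \<sigma>) (\<beta> + axis j 1)
        \<le> K * (r' + 1 / r) * weight r (Flat \<sigma>) \<beta>"
      unfolding w m_def .
    have ge1: "1 \<le> real (Suc m) powr q" using q by (intro ge_one_powr_ge_zero) auto
    have "sqrt (real (Suc m) / 2) * r' ^ n * 1 \<le> sqrt (real (Suc m) / 2) * r' ^ n * real (Suc m) powr q"
      using ge1 assms by (intro mult_left_mono) auto
    also have "\<dots> \<le> K * r ^ n" using b by (simp only: mult_ac)
    finally have "sqrt (real (Suc m) / 2) * r' ^ n * F \<le> K * r ^ n * F"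
      using F by (intro mult_right_mono) auto
    also have "\<dots> = K * (1 / r) * (r * r ^ n * F)" using assms by simp
    also have "\<dots> \<le> K * (r' + 1 / r) * (r * r ^ n * (real (Suc m) powr q * F))"
    proof (intro mult_mono)
      show "F \<le> real (Suc m) powr q * F" using mult_right_mono[OF ge1 F] by simp
    qed (use K0 assms F in auto)
    finally show "sqrt (real (Suc (\<beta> $ j)) / 2) * weight r' (Flat \<sigma>) \<beta>
        \<le> K * (r' + 1 / r) * weight r (Flat \<sigma>) (\<beta> + axis j 1)"
      unfolding w m_def by (simp only: mult.assoc)
  qed
qed

lemma weight_pos: "0 < r \<Longrightarrow> 0 < weight r s \<alpha>"
  by (cases s) (simp_all add: mi_fact_def prod_pos)

lemma weight_mono: "0 < r' \<Longrightarrow> r' \<le> r \<Longrightarrow> weight r' s \<alpha> \<le> weight r s \<alpha>"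
  by (cases s) (simp_all add: mult_right_mono power_mono)

lemma ladder_dominated_weight:
  assumes "s \<in> Rflat_closure" "s \<noteq> Real_index 0" "0 < r'" "r' < r"
  shows "ladder_dominated (weight r' s) (weight r s)"
proof (cases s)
  case (Real_index t)
  then have "0 < t" using assms unfolding Rflat_closure_def by auto
  then show ?thesis unfolding Real_index by (intro ladder_dominated_exp_weight assms)
next
  case (Flat \<sigma>)
  then have "0 < \<sigma>" using assms unfolding Rflat_closure_def by auto
  then show ?thesis unfolding Flat by (intro ladder_dominated_flat_weight assms)
qed

section \<open>Finite series\<close>

lemma finite_mi_size_le: "finite {\<alpha> :: 'n::finite multi_index. mi_size \<alpha> \<le> N}"
proof (rule finite_subset)
  show "finite (vec_lambda ` (PiE UNIV (\<lambda>_::'n. {..N})))"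
    by (intro finite_imageI finite_PiE) auto
  show "{\<alpha> :: 'n multi_index. mi_size \<alpha> \<le> N} \<subseteq> vec_lambda ` (PiE UNIV (\<lambda>_::'n. {..N}))"
  proof
    fix \<alpha> :: "'n multi_index" assume "\<alpha> \<in> {\<alpha>. mi_size \<alpha> \<le> N}"
    then have "vec_nth \<alpha> \<in> PiE UNIV (\<lambda>_::'n. {..N})"
      using mi_component_le_size order_trans by fastforce
    then show "\<alpha> \<in> vec_lambda ` (PiE UNIV (\<lambda>_::'n. {..N}))" by (intro image_eqI[where x = "vec_nth \<alpha>"]) simp_all
  qed
qed

text \<open>
  Here \<^term>\<open>up j\<close> passes from degree \<open>k\<close> to \<open>k + 1\<close> while \<^term>\<open>down j\<close> stays in degree \<open>k\<close>, and on
  each step the unbounded coefficients are evaluated at finitely many multi-indices only.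
\<close>
lemma continuous_finite_topology:
  assumes "T \<in> ladder_algebra"
  shows "continuous_map finite_topology finite_topology T"
proof -
  let ?E = "\<lambda>N. {c :: 'a formal_series. \<forall>\<alpha>. N < mi_size \<alpha> \<longrightarrow> c \<alpha> = 0}"
  let ?N = "weighted_norm (\<lambda>_. 1) :: 'a formal_series \<Rightarrow> real"
  have sub: "c \<in> weighted_space (\<lambda>_. 1)" if "c \<in> ?E N" for c N
  proof -
    have "range (\<lambda>\<alpha>. cmod (c \<alpha>) * 1) \<subseteq> insert 0 ((\<lambda>\<alpha>. cmod (c \<alpha>) * 1) ` {\<alpha>. mi_size \<alpha> \<le> N})"
      using that by (auto simp: not_le[symmetric])
    then have "bdd_above (range (\<lambda>\<alpha>. cmod (c \<alpha>) * 1))"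
      by (rule bdd_above_mono[rotated]) (intro bdd_above_finite finite.insertI finite_imageI finite_mi_size_le)
    then show ?thesis by (simp only: weighted_space_def mem_Collect_eq)
  qed
  have sn: "seminorm_on (weighted_space (\<lambda>_. 1)) ?N"
    by (rule seminorm_weighted_norm(2)) simp
  interpret C: seminormed_chain "UNIV :: nat set" ?E "\<lambda>_. ?N"
  proof
    show "subspace_of_series (?E i)" for i
      by (simp add: subspace_of_series_def)
    show "seminorm_on (?E i) ?N" for i
      using sn sub[of _ i] unfolding seminorm_on_def by blast
    show "(?E i \<subseteq> ?E k \<and> (\<forall>c\<in>?E i. ?N c \<le> ?N c)) \<or> (?E k \<subseteq> ?E i \<and> (\<forall>c\<in>?E k. ?N c \<le> ?N c))" for i k
      using linear[of i k] by force
  qed simp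
  have nonneg: "0 \<le> ?N c" if "c \<in> ?E k" for c k
    using sn sub[OF that] unfolding seminorm_on_def by blast
  have le: "cmod (c \<alpha>) \<le> ?N c" if "c \<in> ?E k" for c \<alpha> k
    using le_weighted_norm[OF sub[OF that], of \<alpha>] by simp
  have norm_le: "?N c \<le> B" if "\<And>\<alpha>. cmod (c \<alpha>) \<le> B" for c :: "'a formal_series" and B
    by (rule weighted_norm_le(2)) (simp add: that)
  have "C.maps (up j) k (Suc k)" for j k
    unfolding C.maps_def
  proof (intro exI[of _ "sqrt (real (Suc k) / 2)"] conjI ballI)
    fix c assume c: "c \<in> ?E k"
    have ne: "mi_size \<alpha> \<le> Suc k" if "up j c \<alpha> \<noteq> 0" for \<alpha>
    proof -
      have "\<alpha> $ j \<noteq> 0" "c (\<alpha> - axis j 1) \<noteq> 0" using that by (auto simp: up_def)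
      then have "mi_size (\<alpha> - axis j 1) \<le> k" using c by (auto simp: not_less[symmetric])
      moreover have "\<alpha> = (\<alpha> - axis j 1) + axis j 1"
        using \<open>\<alpha> $ j \<noteq> 0\<close> by (auto simp: vec_eq_iff axis_def)
      ultimately show ?thesis using mi_size_add_axis[of "\<alpha> - axis j 1" j] by simp
    qed
    then show "up j c \<in> ?E (Suc k)" by (auto simp: not_less[symmetric])
    have "cmod (up j c \<alpha>) \<le> sqrt (real (Suc k) / 2) * ?N c" for \<alpha>
    proof (cases "up j c \<alpha> = 0")
      case True
      then show ?thesis using nonneg[OF c] by simp
    next
      case False
      then have "\<alpha> $ j \<le> Suc k" using ne mi_component_le_size order_trans by blast
      then have "sqrt (real (\<alpha> $ j) / 2) * cmod (c (\<alpha> - axis j 1)) \<le> sqrt (real (Suc k) / 2) * ?N c"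
        by (intro mult_mono le[OF c]) auto
      then show ?thesis by (simp add: up_def norm_mult)
    qed
    then show "?N (up j c) \<le> sqrt (real (Suc k) / 2) * ?N c" by (rule norm_le)
  qed simp
  moreover have "C.maps (down j) k k" for j k
    unfolding C.maps_def
  proof (intro exI[of _ "sqrt (real (Suc k) / 2)"] conjI ballI)
    fix c assume c: "c \<in> ?E k"
    have ne: "Suc (mi_size \<alpha>) \<le> k" if "down j c \<alpha> \<noteq> 0" for \<alpha>
    proof -
      have "c (\<alpha> + axis j 1) \<noteq> 0" using that by (auto simp: down_def)
      then have "\<not> k < mi_size (\<alpha> + axis j 1)" using c by blast
      then show ?thesis unfolding mi_size_add_axis by simp
    qed
    then show "down j c \<in> ?E k" by (force simp: not_less[symmetric])
    have "cmod (down j c \<alpha>) \<le> sqrt (real (Suc k) / 2) * ?N c" for \<alpha>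
    proof (cases "down j c \<alpha> = 0")
      case True
      then show ?thesis using nonneg[OF c] by simp
    next
      case False
      then have "\<alpha> $ j \<le> k" using ne[OF False] mi_component_le_size[of \<alpha> j] by linarith
      then have "sqrt (real (Suc (\<alpha> $ j)) / 2) * cmod (c (\<alpha> + axis j 1)) \<le> sqrt (real (Suc k) / 2) * ?N c"
        by (intro mult_mono le[OF c]) auto
      then show ?thesis by (simp add: down_def norm_mult)
    qed
    then show "?N (down j c) \<le> sqrt (real (Suc k) / 2) * ?N c" by (rule norm_le)
  qed simp
  ultimately show ?thesis
    unfolding finite_topology_def using assms by (intro C.continuous_inductive) blast+
qed

section \<open>Hermite expansions\<close>

lemma hermite_expansion_add:
  assumes "f \<in> schwartz" "g \<in> schwartz"
  shows "hermite_expansion (\<lambda>x. f x + g x) = (\<lambda>\<alpha>. hermite_expansion f \<alpha> + hermite_expansion g \<alpha>)"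
  using assms
  by (simp add: hermite_expansion_def distrib_right fun_eq_iff
      schwartz_integrable_mult[OF _ schwartz_hermite])

lemma hermite_expansion_scale:
  "hermite_expansion (\<lambda>x. k * f x) = (\<lambda>\<alpha>. k * hermite_expansion f \<alpha>)"
  by (simp add: hermite_expansion_def mult.assoc fun_eq_iff)

lemma sqrt_double: "sqrt (2 * t) = 2 * sqrt (t / 2)"
  using real_sqrt_mult[of 4 "t / 2"] by simp

text \<open>
  Integration by parts: creation and annihilation operators are transposes of each other for the
  bilinear pairing \<open>\<integral> f h\<close>, and they act on Hermite functions by shifting the index.
\<close>
lemma hermite_expansion_raise:
  fixes f :: "real ^ 'n::finite \<Rightarrow> complex"
  assumes f: "f \<in> schwartz"
  shows "hermite_expansion (raise j f) = (\<lambda>\<alpha>. 2 * up j (hermite_expansion f) \<alpha>)"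
proof
  fix \<alpha> :: "'n multi_index"
  let ?h = "hermite \<alpha>"
  note int = schwartz_integrable_mult[OF _ schwartz_hermite[of \<alpha>]]
    schwartz_integrable_mult[OF f]
  have "hermite_expansion (raise j f) \<alpha> =
      (LINT x|lborel. of_real (x $ j) * f x * ?h x - partial_deriv j f x * ?h x)"
    by (simp add: hermite_expansion_def raise_def left_diff_distrib)
  also have "\<dots> = (LINT x|lborel. of_real (x $ j) * f x * ?h x) - (LINT x|lborel. partial_deriv j f x * ?h x)"
    by (intro Bochner_Integration.integral_diff int schwartz_coord schwartz_partial_deriv f)
  also have "\<dots> = (LINT x|lborel. f x * (of_real (x $ j) * ?h x)) + (LINT x|lborel. f x * partial_deriv j ?h x)"
    by (simp add: schwartz_integral_by_parts[OF f schwartz_hermite] mult_ac)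
  also have "\<dots> = (LINT x|lborel. f x * lower j ?h x)"
    unfolding lower_def distrib_left
    by (intro Bochner_Integration.integral_add[symmetric] int schwartz_coord schwartz_partial_deriv schwartz_hermite)
  also have "\<dots> = of_real (sqrt (2 * real (\<alpha> $ j))) * hermite_expansion f (\<alpha> - axis j 1)"
    by (simp only: lower_hermite hermite_expansion_def integral_mult_right_zero
        mult.left_commute[of "f _" "of_real (sqrt _)"])
  also have "sqrt (2 * real (\<alpha> $ j)) = 2 * sqrt (real (\<alpha> $ j) / 2)"
    by (rule sqrt_double)
  finally show "hermite_expansion (raise j f) \<alpha> = 2 * up j (hermite_expansion f) \<alpha>"
    by (simp add: up_def)
qed

lemma hermite_expansion_lower:
  fixes f :: "real ^ 'n::finite \<Rightarrow> complex"
  assumes f: "f \<in> schwartz"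
  shows "hermite_expansion (lower j f) = (\<lambda>\<alpha>. 2 * down j (hermite_expansion f) \<alpha>)"
proof
  fix \<alpha> :: "'n multi_index"
  let ?h = "hermite \<alpha>"
  note int = schwartz_integrable_mult[OF _ schwartz_hermite[of \<alpha>]]
    schwartz_integrable_mult[OF f]
  have "hermite_expansion (lower j f) \<alpha> =
      (LINT x|lborel. of_real (x $ j) * f x * ?h x + partial_deriv j f x * ?h x)"
    by (simp add: hermite_expansion_def lower_def distrib_right)
  also have "\<dots> = (LINT x|lborel. of_real (x $ j) * f x * ?h x) + (LINT x|lborel. partial_deriv j f x * ?h x)"
    by (intro Bochner_Integration.integral_add int schwartz_coord schwartz_partial_deriv f)
  also have "\<dots> = (LINT x|lborel. f x * (of_real (x $ j) * ?h x)) - (LINT x|lborel. f x * partial_deriv j ?h x)"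
    by (simp add: schwartz_integral_by_parts[OF f schwartz_hermite] mult_ac)
  also have "\<dots> = (LINT x|lborel. f x * raise j ?h x)"
    unfolding raise_def right_diff_distrib
    by (intro Bochner_Integration.integral_diff[symmetric] int schwartz_coord schwartz_partial_deriv schwartz_hermite)
  also have "\<dots> = of_real (sqrt (2 * real (Suc (\<alpha> $ j)))) * hermite_expansion f (\<alpha> + axis j 1)"
    by (simp only: raise_hermite hermite_expansion_def integral_mult_right_zero
        mult.left_commute[of "f _" "of_real (sqrt _)"])
  also have "sqrt (2 * real (Suc (\<alpha> $ j))) = 2 * sqrt (real (Suc (\<alpha> $ j)) / 2)"
    by (rule sqrt_double)
  finally show "hermite_expansion (lower j f) \<alpha> = 2 * down j (hermite_expansion f) \<alpha>"
    by (simp add: down_def)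
qed

text \<open>
  The operators on the Schwartz space that act on Hermite expansions through the ladder algebra. That
  they preserve the Schwartz space is part of the notion, as it is needed to compose them.
\<close>
definition ladder_represented :: "((real ^ 'n::finite \<Rightarrow> complex) \<Rightarrow> real ^ 'n \<Rightarrow> complex) \<Rightarrow> bool" where
  "ladder_represented A \<longleftrightarrow> (\<exists>T\<in>ladder_algebra. \<forall>f\<in>schwartz.
     A f \<in> schwartz \<and> hermite_expansion (A f) = T (hermite_expansion f))"

lemma ladder_represented_ident: "ladder_represented (\<lambda>f. f)"
  unfolding ladder_represented_def by (intro bexI[OF _ ladder_algebra.ident]) simp

lemma ladder_represented_add:
  assumes "ladder_represented A" "ladder_represented B"
  shows "ladder_represented (\<lambda>f x. A f x + B f x)"
proof -
  obtain T U where "T \<in> ladder_algebra" "U \<in> ladder_algebra"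
    and *: "\<And>f. f \<in> schwartz \<Longrightarrow> A f \<in> schwartz \<and> hermite_expansion (A f) = T (hermite_expansion f)"
      "\<And>f. f \<in> schwartz \<Longrightarrow> B f \<in> schwartz \<and> hermite_expansion (B f) = U (hermite_expansion f)"
    using assms unfolding ladder_represented_def by blast
  then show ?thesis
    unfolding ladder_represented_def
    by (intro bexI[OF _ ladder_algebra.add[of T U]]) (simp_all add: schwartz_add hermite_expansion_add *)
qed

lemma ladder_represented_scale:
  assumes "ladder_represented A"
  shows "ladder_represented (\<lambda>f x. k * A f x)"
proof -
  obtain T where "T \<in> ladder_algebra"
    and *: "\<And>f. f \<in> schwartz \<Longrightarrow> A f \<in> schwartz \<and> hermite_expansion (A f) = T (hermite_expansion f)"
    using assms unfolding ladder_represented_def by blast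
  then show ?thesis
    unfolding ladder_represented_def
    by (intro bexI[OF _ ladder_algebra.scale[of T k]]) (simp_all add: schwartz_scale hermite_expansion_scale *)
qed

lemma ladder_represented_raise:
  assumes "ladder_represented A"
  shows "ladder_represented (\<lambda>f. raise j (A f))"
proof -
  obtain T where "T \<in> ladder_algebra"
    and *: "\<And>f. f \<in> schwartz \<Longrightarrow> A f \<in> schwartz \<and> hermite_expansion (A f) = T (hermite_expansion f)"
    using assms unfolding ladder_represented_def by blast
  then show ?thesis
    unfolding ladder_represented_def
    by (intro bexI[OF _ ladder_algebra.scale[OF ladder_algebra.up[of T j], of 2]])
      (simp_all add: schwartz_raise hermite_expansion_raise *)
qed

lemma ladder_represented_lower:
  assumes "ladder_represented A"
  shows "ladder_represented (\<lambda>f. lower j (A f))"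
proof -
  obtain T where "T \<in> ladder_algebra"
    and *: "\<And>f. f \<in> schwartz \<Longrightarrow> A f \<in> schwartz \<and> hermite_expansion (A f) = T (hermite_expansion f)"
    using assms unfolding ladder_represented_def by blast
  then show ?thesis
    unfolding ladder_represented_def
    by (intro bexI[OF _ ladder_algebra.scale[OF ladder_algebra.down[of T j], of 2]])
      (simp_all add: schwartz_lower hermite_expansion_lower *)
qed

lemma ladder_represented_coord:
  assumes "ladder_represented A"
  shows "ladder_represented (\<lambda>f x. of_real (x $ j) * A f x)"
proof -
  have "(\<lambda>f x. of_real (x $ j) * A f x) = (\<lambda>f x. (1/2) * (raise j (A f) x + lower j (A f) x))"
    by (simp add: raise_def lower_def fun_eq_iff)
  then show ?thesis
    using assms by (simp only: ladder_represented_scale ladder_represented_add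
        ladder_represented_raise ladder_represented_lower)
qed

lemma ladder_represented_D_op:
  assumes "ladder_represented A"
  shows "ladder_represented (\<lambda>f. D_op j (A f))"
proof -
  have "(\<lambda>f. D_op j (A f)) = (\<lambda>f x. (- \<i> / 2) * (lower j (A f) x + (-1) * raise j (A f) x))"
    by (simp add: D_op_def raise_def lower_def fun_eq_iff)
  then show ?thesis
    using assms by (simp only: ladder_represented_scale ladder_represented_add
        ladder_represented_raise ladder_represented_lower)
qed

lemma ladder_represented_D_ops: "ladder_represented (\<lambda>f. foldr D_op js f)"
proof (induction js)
  case Nil
  then show ?case using ladder_represented_ident by simp
next
  case (Cons j js)
  then show ?case using ladder_represented_D_op by simp
qed

lemma ladder_represented_mi_power:
  assumes "ladder_represented A"
  shows "ladder_represented (\<lambda>f x. of_real (mi_power x \<beta>) * A f x)"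
proof -
  have "ladder_represented (\<lambda>f x. of_real (mi_power x (\<chi> i. count_list js i)) * A f x)" for js
  proof (induction js)
    case Nil
    then show ?case using assms by (simp add: mi_power_def)
  next
    case (Cons j js)
    have "(\<chi> i. count_list (j # js) i) = (\<chi> i. count_list js i) + axis j 1"
      by (auto simp: vec_eq_iff axis_def)
    with ladder_represented_coord[OF Cons, of j] show ?case
      by (simp only: mi_power_add_axis of_real_mult mult_ac)
  qed
  from this[of "mi_listing \<beta>"] show ?thesis by (simp add: count_list_mi_listing)
qed

lemma ladder_represented_sum:
  assumes "finite K" "\<And>k. k \<in> K \<Longrightarrow> ladder_represented (A k)"
  shows "ladder_represented (\<lambda>f x. \<Sum>k\<in>K. A k f x)"
  using assms
proof (induction K)
  case empty
  then show ?case using ladder_represented_scale[OF ladder_represented_ident, of 0] by simp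
next
  case (insert k K)
  then show ?case by (simp add: ladder_represented_add)
qed

lemma ladder_represented_pdo: "ladder_represented (pdo a)"
proof -
  \<comment> \<open>first apply the derivatives in the order of the listing, then multiply by the monomial\<close>
  have "ladder_represented (\<lambda>f x. \<Sum>k\<in>Poly_Mapping.keys a.
      Poly_Mapping.lookup a k * (of_real (mi_power x (fst k)) * foldr D_op (mi_listing (snd k)) f x))"
    by (intro ladder_represented_sum ladder_represented_scale ladder_represented_mi_power
        ladder_represented_D_ops) simp
  also have "(\<lambda>f x. \<Sum>k\<in>Poly_Mapping.keys a.
      Poly_Mapping.lookup a k * (of_real (mi_power x (fst k)) * foldr D_op (mi_listing (snd k)) f x)) = pdo a"
    by (simp add: fun_eq_iff pdo_def mi_iterate_def split_def mult.assoc)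
  finally show ?thesis .
qed

text \<open>
  The extension is the element of the ladder algebra that represents the operator; the continuity is
  immediate since each coefficient of the result depends on finitely many coefficients of the argument.
\<close>
lemma continuous_extension_exists:
  "\<exists>T\<in>ladder_algebra. is_continuous_extension a T"
proof -
  obtain T where T: "T \<in> ladder_algebra"
    and "\<forall>f\<in>schwartz. pdo a f \<in> schwartz \<and> hermite_expansion (pdo a f) = T (hermite_expansion f)"
    using ladder_represented_pdo unfolding ladder_represented_def by blast
  then have "is_continuous_extension a T"
    unfolding is_continuous_extension_def
    by (simp add: linear_ladder_algebra continuous_formal_ladder_algebra)
  with T show ?thesis by blast
qed

section \<open>Uniqueness of the extension\<close>

definition delta :: "'n multi_index \<Rightarrow> 'n formal_series" where
  "delta \<alpha> \<beta> = (if \<beta> = \<alpha> then 1 else 0)"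

lemma integral_gauss_square: "(LINT x|lborel. gauss (x :: real ^ 'n::finite) * gauss x) \<noteq> 0"
proof
  assume 0: "(LINT x|lborel. gauss (x :: real ^ 'n) * gauss x) = 0"
  have eq: "gauss x * gauss x = of_real (exp (- (norm x)\<^sup>2))" for x :: "real ^ 'n"
    unfolding gauss_def by (simp flip: exp_add of_real_mult)
  have "integrable lborel (\<lambda>x :: real ^ 'n. gauss x * gauss x)"
    by (intro schwartz_integrable_mult schwartz_gauss)
  then have int: "integrable lborel (\<lambda>x :: real ^ 'n. exp (- (norm x)\<^sup>2))"
    unfolding eq complex_of_real_integrable_eq .
  have "(LINT x|lborel. exp (- (norm (x :: real ^ 'n))\<^sup>2)) = 0"
    using 0 unfolding eq by simp
  then have "AE x in lborel. exp (- (norm (x :: real ^ 'n))\<^sup>2) = 0"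
    using integral_nonneg_eq_0_iff_AE[OF int] by simp
  then have "ae_filter (lborel :: (real ^ 'n) measure) = bot"
    by (simp add: trivial_limit_def)
  then show False
    by (simp add: ae_filter_eq_bot_iff)
qed

text \<open>
  The annihilation operators kill the Gaussian, so by \<open>hermite_expansion_lower\<close> every coefficient at an
  index of the form \<open>\<beta> + e\<^sub>j\<close> vanishes; the remaining one is a positive multiple of the integral of
  \<open>exp (- |x|\<^sup>2)\<close>.
\<close>
lemma hermite_expansion_gauss:
  "\<exists>k. k \<noteq> 0 \<and> hermite_expansion gauss = (\<lambda>\<beta> :: 'n::finite multi_index. k * delta 0 \<beta>)"
proof (intro exI conjI)
  let ?c = "hermite_expansion gauss :: 'n formal_series"
  have "mset (mi_listing (0 :: nat ^ 'n)) = mset []"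
    unfolding mset_eq_iff_count_list by (simp add: count_list_mi_listing)
  then have "hermite 0 = (\<lambda>x. of_real (hermite_const (0 :: nat ^ 'n)) * gauss (x :: real ^ 'n))"
    unfolding hermite_eq_excited[of "0 :: nat ^ 'n"] by simp
  from fun_cong[OF this] have "?c 0 = of_real (hermite_const (0 :: nat ^ 'n)) * (LINT x|lborel. gauss (x :: real ^ 'n) * gauss x)"
    unfolding hermite_expansion_def
    by (simp only: integral_mult_right_zero mult.left_commute[of "gauss _" "of_real (hermite_const _)"])
  then show "?c 0 \<noteq> 0"
    using integral_gauss_square hermite_const_pos[of "0 :: nat ^ 'n"] by simp
  have "(\<lambda>\<alpha>. 2 * down j ?c \<alpha>) = hermite_expansion (\<lambda>x. 0)" for j
    using hermite_expansion_lower[OF schwartz_gauss, of j] unfolding lower_gauss by simp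
  then have 0: "?c (\<beta> + axis j 1) = 0" for \<beta> j
    by (auto simp: fun_eq_iff down_def hermite_expansion_def)
  have "?c \<beta> = 0" if "\<beta> \<noteq> 0" for \<beta>
  proof -
    obtain j where "\<beta> $ j \<noteq> 0" using \<open>\<beta> \<noteq> 0\<close> by (auto simp: vec_eq_iff)
    then have "\<beta> = (\<beta> - axis j 1) + axis j 1" by (auto simp: vec_eq_iff axis_def)
    then show ?thesis using 0 by metis
  qed
  then show "?c = (\<lambda>\<beta>. ?c 0 * delta 0 \<beta>)"
    by (auto simp: delta_def fun_eq_iff)
qed

text \<open>
  The operator \<^term>\<open>up j\<close> moves the single nonzero coefficient of the Gaussian from index to index, and
  the factor it picks up never vanishes.
\<close>
lemma hermite_expansion_excited:
  fixes js :: "'n::finite list"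
  shows
  "\<exists>k. k \<noteq> 0 \<and> hermite_expansion (excited js) = (\<lambda>\<beta>. k * delta (\<chi> i. count_list js i) \<beta>)"
proof (induction js)
  case Nil
  have "(\<chi> i. count_list ([] :: 'n list) i) = 0" by (simp add: vec_eq_iff)
  then show ?case using hermite_expansion_gauss[where 'n = 'n] by simp
next
  case (Cons j js)
  let ?\<alpha> = "\<chi> i. count_list js i"
  have suc: "(\<chi> i. count_list (j # js) i) = ?\<alpha> + axis j 1"
    by (auto simp: vec_eq_iff axis_def)
  obtain k where k: "k \<noteq> 0" and eq: "hermite_expansion (excited js) = (\<lambda>\<beta>. k * delta ?\<alpha> \<beta>)"
    using Cons by blast
  let ?k = "2 * of_real (sqrt (real (Suc (?\<alpha> $ j)) / 2)) * k"
  have "2 * up j (\<lambda>\<beta>. k * delta ?\<alpha> \<beta>) \<beta> = ?k * delta (?\<alpha> + axis j 1) \<beta>" for \<beta>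
  proof (cases "\<beta> $ j = 0")
    case True
    then have "\<beta> \<noteq> ?\<alpha> + axis j 1" by (auto simp: axis_def)
    with True show ?thesis by (simp add: up_def delta_def)
  next
    case False
    then have "\<beta> - axis j 1 = ?\<alpha> \<longleftrightarrow> \<beta> = ?\<alpha> + axis j 1"
      by (auto simp: vec_eq_iff axis_def)
    then show ?thesis by (auto simp: up_def delta_def axis_def)
  qed
  then have "(\<lambda>\<beta>. 2 * up j (hermite_expansion (excited js)) \<beta>) = (\<lambda>\<beta>. ?k * delta (?\<alpha> + axis j 1) \<beta>)"
    unfolding eq by (rule ext)
  then have "hermite_expansion (excited (j # js)) = (\<lambda>\<beta>. ?k * delta (?\<alpha> + axis j 1) \<beta>)"
    by (simp only: foldr.simps o_apply hermite_expansion_raise[OF schwartz_excited])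
  moreover have "?k \<noteq> 0" using k by simp
  ultimately show ?case unfolding suc by blast
qed

text \<open>
  Every \<^term>\<open>delta \<alpha>\<close> is a multiple of the expansion of a Schwartz function, on which the operator is
  prescribed. Linearity extends the agreement to finite series, and these are dense: the truncations of
  a formal series converge to it in every coefficient.
\<close>
lemma extension_unique:
  fixes T U :: "'n::finite formal_series \<Rightarrow> 'n formal_series"
  assumes T: "is_continuous_extension a T" and U: "is_continuous_extension a U"
  shows "T = U"
proof -
  have lin: "linear_operator T" "linear_operator U"
    using T U unfolding is_continuous_extension_def by blast+
  have add: "T (\<lambda>\<alpha>. c \<alpha> + d \<alpha>) = (\<lambda>\<alpha>. T c \<alpha> + T d \<alpha>)" "U (\<lambda>\<alpha>. c \<alpha> + d \<alpha>) = (\<lambda>\<alpha>. U c \<alpha> + U d \<alpha>)" for c d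
    using lin unfolding linear_operator_def by blast+
  have scale: "T (\<lambda>\<alpha>. k * c \<alpha>) = (\<lambda>\<alpha>. k * T c \<alpha>)" "U (\<lambda>\<alpha>. k * c \<alpha>) = (\<lambda>\<alpha>. k * U c \<alpha>)" for c k
    using lin unfolding linear_operator_def by blast+
  have delta: "T (delta \<alpha>) = U (delta \<alpha>)" for \<alpha>
  proof -
    let ?f = "excited (mi_listing \<alpha>)"
    obtain k where k: "k \<noteq> 0" and eq: "hermite_expansion ?f = (\<lambda>\<beta>. k * delta \<alpha> \<beta>)"
      using hermite_expansion_excited[of "mi_listing \<alpha>"] by (auto simp: count_list_mi_listing)
    have "T (hermite_expansion ?f) = U (hermite_expansion ?f)"
      using T U schwartz_excited[of "mi_listing \<alpha>"] unfolding is_continuous_extension_def by simp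
    then have "k * T (delta \<alpha>) \<beta> = k * U (delta \<alpha>) \<beta>" for \<beta>
      unfolding eq scale by (rule fun_cong)
    with k show ?thesis by auto
  qed
  have fin: "T (\<lambda>\<alpha>. if \<alpha> \<in> A then c \<alpha> else 0) = U (\<lambda>\<alpha>. if \<alpha> \<in> A then c \<alpha> else 0)" if "finite A" for A c
    using that
  proof induction
    case empty
    then show ?case using scale[of 0 "\<lambda>\<alpha>. 0"] by simp
  next
    case (insert \<beta> A)
    have "(\<lambda>\<alpha>. if \<alpha> \<in> insert \<beta> A then c \<alpha> else 0) =
        (\<lambda>\<alpha>. (if \<alpha> \<in> A then c \<alpha> else 0) + c \<beta> * delta \<beta> \<alpha>)"
      using insert by (auto simp: delta_def)
    then show ?case by (simp only: add scale delta insert.IH)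
  qed
  show ?thesis
  proof (intro ext)
    fix c :: "'n formal_series" and \<beta> :: "'n multi_index"
    let ?c = "\<lambda>N \<alpha>. if \<alpha> \<in> {\<alpha>. mi_size \<alpha> \<le> N} then c \<alpha> else 0"
    have c: "limitin formal_topology ?c c sequentially"
      unfolding formal_topology_def limitin_componentwise
    proof (intro conjI ballI)
      fix \<alpha>
      have "\<forall>\<^sub>F N in sequentially. ?c N \<alpha> = c \<alpha>"
        using eventually_ge_at_top[of "mi_size \<alpha>"] by eventually_elim simp
      then show "limitin euclidean (\<lambda>N. ?c N \<alpha>) (c \<alpha>) sequentially"
        by (simp add: tendsto_eventually)
    qed auto
    have lim: "(\<lambda>N. V (?c N) \<beta>) \<longlonglongrightarrow> V c \<beta>"
      if "continuous_map formal_topology formal_topology V" for V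
      using continuous_map_limit[OF that c]
      unfolding formal_topology_def limitin_componentwise by (simp add: o_def)
    have "continuous_map formal_topology formal_topology T" "continuous_map formal_topology formal_topology U"
      using T U unfolding is_continuous_extension_def by blast+
    note lims = this[THEN lim]
    have "T (?c N) = U (?c N)" for N
      by (rule fin[OF finite_mi_size_le])
    from lims(1)[unfolded this] lims(2) show "T c \<beta> = U c \<beta>"
      by (rule LIMSEQ_unique)
  qed
qed

theorem proposition7p2:
  fixes a :: "('n::finite) symbol_poly" and s :: flat_index
  assumes "s \<in> Rflat_closure"
  shows "(\<exists>!T. is_continuous_extension a T) \<and>
    (\<forall>T. is_continuous_extension a T \<longrightarrow>
      continuous_map (H0_space s) (H0_space s) T \<and>
      continuous_map (H_space s) (H_space s) T \<and>
      continuous_map (H0_dual s) (H0_dual s) T \<and>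
      continuous_map (H_dual s) (H_dual s) T)"
proof -
  obtain T where T: "T \<in> ladder_algebra" and ext: "is_continuous_extension a T"
    using continuous_extension_exists by blast
  have "T (\<lambda>_. 0) = (\<lambda>_. 0)"
  proof -
    have "T (\<lambda>\<alpha>. k * c \<alpha>) = (\<lambda>\<alpha>. k * T c \<alpha>)" for k c
      using linear_ladder_algebra[OF T] unfolding linear_operator_def by blast
    from this[of 0 "\<lambda>_. 0"] show ?thesis by simp
  qed
  then have trivial: "continuous_map (discrete_topology {\<lambda>_. 0}) (discrete_topology {\<lambda>_. 0}) T"
    by simp
  have "continuous_map (H0_space s) (H0_space s) T \<and>
      continuous_map (H_space s) (H_space s) T \<and>
      continuous_map (H0_dual s) (H0_dual s) T \<and>
      continuous_map (H_dual s) (H_dual s) T"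
  proof (cases "s = Real_index 0")
    case True
    then show ?thesis
      using trivial continuous_finite_topology[OF T] continuous_formal_ladder_algebra[OF T]
      by (simp add: H0_space_def H_space_def H0_dual_def H_dual_def)
  next
    case False
    have "ladder_dominated (weight r' s :: 'n multi_index \<Rightarrow> real) (weight r s)" if "0 < r'" "r' < r" for r r'
      by (rule ladder_dominated_weight[OF assms False that])
    from continuous_weighted[OF weight_pos weight_mono this T] False show ?thesis
      by (simp add: H0_space_def H_space_def H0_dual_def H_dual_def)
  qed
  then show ?thesis
    using ext extension_unique by blast
qed

end
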